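(* Let $\mathsf D$ be either $\mathsf{pCPU}_{\min}$ or $\mathsf{pCPU}_{\max}$. Let $\omega\colon A\to B$ be a morphism in $\mathsf D$ and let $\phi,\psi\colon B\to C$ be two generalized morphisms. Then: $$\begin{array}{rcll} \phi\simeq^L_\omega\psi&\Longleftrightarrow&\phi^{\mathrm{op}}(y)-\psi^{\mathrm{op}}(y)\in{}_{\omega^{\mathrm{op}}}N&\ \forall y\in C,\\ \phi\simeq^R_\omega\psi&\Longleftrightarrow&\phi^{\mathrm{op}}(y)-\psi^{\mathrm{op}}(y)\in N_{\omega^{\mathrm{op}}}&\ \forall y\in C,\\ \phi\cong_\omega\psi&\Longleftrightarrow&\phi^{\mathrm{op}}(y)-\psi^{\mathrm{op}}(y)\in SN_{\omega^{\mathrm{op}}}&\ \forall y\in C. \end{array}$$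
   Context: All algebras are unital over $\mathbb C$. A pre-C*-algebra is a complex $*$-algebra with a submultiplicative norm satisfying $\|x^*x\|=\|x\|^2$, with completion $\widehat A$. $A\odot_{\min}B$ (resp. $A\odot_{\max}B$) is the algebraic tensor product with the norm induced from $\widehat A\otimes_{\min}\widehat B$ (resp. $\widehat A\otimes_{\max}\widehat B$). An element $x\in A$ is positive if $x=y^*y$ for some $y\in\widehat A$; a unital linear map is positive if it preserves positive elements, and completely positive if its tensor product with $\mathrm{id}_{M_n}$ is positive for all $n$. The category $\mathsf{pC}^*\mathsf{ulin}^{\mathrm{op}}_{\min}$ (resp. $\max$) has pre-C*-algebras as objects; a morphism $\phi\colon A\to B$ is the formal opposite of a unital linear map $\phi^{\mathrm{op}}\colon B\to A$; the monoidal product $\odot$ is $\odot_{\min}$ (resp. $\odot_{\max}$). The morphism $\mathrm{copy}_A\colon A\to A\odot A$ is the opposite of multiplication $A\odot A\to A$. $\mathsf{pCPU}_{\min}$ (resp. $\mathsf{pCPU}_{\max}$) is the subcategory given by completely positive unital maps; "generalized morphism" means morphism of $\mathsf{pC}^*\mathsf{ulin}^{\mathrm{op}}_{\min}$ (resp. $\max$). Almost sure equalities, for $\omega\colon A\to B$ and $\phi,\psi\colon B\to C$: - left: $\phi\simeq^L_\omega\psi$ iff $(\phi\odot\mathrm{id}_B)\,\mathrm{copy}_B\,\omega=(\psi\odot\mathrm{id}_B)\,\mathrm{copy}_B\,\omega$; - right: $\phi\simeq^R_\omega\psi$ iff $(\mathrm{id}_B\odot\phi)\,\mathrm{copy}_B\,\omega=(\mathrm{id}_B\odot\psi)\,\mathrm{copy}_B\,\omega$;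 - symmetric: $\phi\cong_\omega\psi$ iff $(\mathrm{id}_B\odot\phi\odot\mathrm{id}_B)\,\mathrm{copy}^3_B\,\omega=(\mathrm{id}_B\odot\psi\odot\mathrm{id}_B)\,\mathrm{copy}^3_B\,\omega$, where $\mathrm{copy}^3_B\colon B\to B\odot B\odot B$ is the iterated copy (the opposite of the threefold multiplication). Nullspaces of a completely positive unital map $\omega^{\mathrm{op}}\colon B\to A$: ${}_{\omega^{\mathrm{op}}}N:=\{x\in B:\omega^{\mathrm{op}}(xx^* )=0\}$, $N_{\omega^{\mathrm{op}}}:=\{x\in B:\omega^{\mathrm{op}}(x^*x)=0\}$, $SN_{\omega^{\mathrm{op}}}:=\{x\in B:\omega^{\mathrm{op}}(y^*x^*xy)=0\ \forall y\in B\}$. *)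

theory Defs
  imports Complex_Main "HOL-Algebra.Module" "HOL-Library.Poly_Mapping"
begin

section \<open>Unital complex *-algebras and pre-C*-algebras\<close>

definition complex_ring :: "complex ring" where
  "complex_ring = \<lparr>carrier = UNIV, mult = (*), one = 1, zero = 0, add = (+)\<rparr>"

record 'a star_alg = "(complex, 'a) module" +
  star :: "'a \<Rightarrow> 'a"

record 'a pre_cstar = "'a star_alg" +
  nrm :: "'a \<Rightarrow> real"

text \<open>The zero algebra is not excluded, neither here nor for pre-C*-algebras.\<close>

locale star_algebra = module complex_ring A + ring A
  for A :: "('a, 'm) star_alg_scheme" (structure) +
  assumes smult_mult_left:
      "\<lbrakk>x \<in> carrier A; y \<in> carrier A\<rbrakk> \<Longrightarrow> (c \<odot> x) \<otimes> y = c \<odot> (x \<otimes> y)"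
    and smult_mult_right:
      "\<lbrakk>x \<in> carrier A; y \<in> carrier A\<rbrakk> \<Longrightarrow> x \<otimes> (c \<odot> y) = c \<odot> (x \<otimes> y)"
    and star_closed: "x \<in> carrier A \<Longrightarrow> star A x \<in> carrier A"
    and star_star: "x \<in> carrier A \<Longrightarrow> star A (star A x) = x"
    and star_add:
      "\<lbrakk>x \<in> carrier A; y \<in> carrier A\<rbrakk> \<Longrightarrow> star A (x \<oplus> y) = star A x \<oplus> star A y"
    and star_smult: "x \<in> carrier A \<Longrightarrow> star A (c \<odot> x) = cnj c \<odot> star A x"
    and star_mult:
      "\<lbrakk>x \<in> carrier A; y \<in> carrier A\<rbrakk> \<Longrightarrow> star A (x \<otimes> y) = star A y \<otimes> star A x"

locale pre_cstar_algebra = star_algebra A for A :: "'a pre_cstar" (structure) +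
  assumes nrm_nonneg: "x \<in> carrier A \<Longrightarrow> 0 \<le> nrm A x"
    and nrm_eq_0_iff: "x \<in> carrier A \<Longrightarrow> nrm A x = 0 \<longleftrightarrow> x = \<zero>"
    and nrm_triangle:
      "\<lbrakk>x \<in> carrier A; y \<in> carrier A\<rbrakk> \<Longrightarrow> nrm A (x \<oplus> y) \<le> nrm A x + nrm A y"
    and nrm_smult: "x \<in> carrier A \<Longrightarrow> nrm A (c \<odot> x) = cmod c * nrm A x"
    and nrm_mult:
      "\<lbrakk>x \<in> carrier A; y \<in> carrier A\<rbrakk> \<Longrightarrow> nrm A (x \<otimes> y) \<le> nrm A x * nrm A y"
    and nrm_star_mult: "x \<in> carrier A \<Longrightarrow> nrm A (star A x \<otimes> x) = (nrm A x)\<^sup>2"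

definition with_nrm :: "'a star_alg \<Rightarrow> ('a \<Rightarrow> real) \<Rightarrow> 'a pre_cstar" where
  "with_nrm S p = star_alg.extend S (pre_cstar.fields p)"


section \<open>Completion\<close>

definition cauchy_seqs :: "'a pre_cstar \<Rightarrow> (nat \<Rightarrow> 'a) set" where
  "cauchy_seqs A = {s. (\<forall>n. s n \<in> carrier A) \<and>
     (\<forall>e>0. \<exists>N. \<forall>m\<ge>N. \<forall>n\<ge>N. nrm A (s m \<ominus>\<^bsub>A\<^esub> s n) < e)}"

definition cauchy_rel :: "'a pre_cstar \<Rightarrow> ((nat \<Rightarrow> 'a) \<times> (nat \<Rightarrow> 'a)) set" where
  "cauchy_rel A = {(s, t). s \<in> cauchy_seqs A \<and> t \<in> cauchy_seqs A \<and>
     (\<lambda>n. nrm A (s n \<ominus>\<^bsub>A\<^esub> t n)) \<longlonglongrightarrow> 0}"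

definition completion_emb :: "'a pre_cstar \<Rightarrow> 'a \<Rightarrow> (nat \<Rightarrow> 'a) set" where
  "completion_emb A x = cauchy_rel A `` {\<lambda>_. x}"

text \<open>
  Elements are equivalence classes of Cauchy sequences. In a definition of the form
  \<open>\<Union>s\<in>X. cauchy_rel A `` {h s}\<close> all sets in the union are one and the same class.
\<close>

definition completion :: "'a pre_cstar \<Rightarrow> (nat \<Rightarrow> 'a) set pre_cstar" where
  "completion A =
    \<lparr>carrier = cauchy_seqs A // cauchy_rel A,
     mult = (\<lambda>X Y. \<Union>s\<in>X. \<Union>t\<in>Y. cauchy_rel A `` {\<lambda>n. s n \<otimes>\<^bsub>A\<^esub> t n}),
     one = completion_emb A \<one>\<^bsub>A\<^esub>,
     zero = completion_emb A \<zero>\<^bsub>A\<^esub>,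
     add = (\<lambda>X Y. \<Union>s\<in>X. \<Union>t\<in>Y. cauchy_rel A `` {\<lambda>n. s n \<oplus>\<^bsub>A\<^esub> t n}),
     smult = (\<lambda>c X. \<Union>s\<in>X. cauchy_rel A `` {\<lambda>n. c \<odot>\<^bsub>A\<^esub> s n}),
     star = (\<lambda>X. \<Union>s\<in>X. cauchy_rel A `` {\<lambda>n. star A (s n)}),
     nrm = (\<lambda>X. the_elem ((\<lambda>s. lim (\<lambda>n. nrm A (s n))) ` X))\<rparr>"


section \<open>Complete positivity\<close>

definition matrix_alg :: "nat \<Rightarrow> ('a, 'm) star_alg_scheme \<Rightarrow> (nat \<times> nat \<Rightarrow> 'a) star_alg" where
  "matrix_alg n A =
    (let I = {..<n} \<times> {..<n} in
    \<lparr>carrier = I \<rightarrow>\<^sub>E carrier A,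
     mult = (\<lambda>X Y. \<lambda>(i, j)\<in>I. \<Oplus>\<^bsub>A\<^esub>k\<in>{..<n}. X (i, k) \<otimes>\<^bsub>A\<^esub> Y (k, j)),
     one = (\<lambda>(i, j)\<in>I. if i = j then \<one>\<^bsub>A\<^esub> else \<zero>\<^bsub>A\<^esub>),
     zero = (\<lambda>_\<in>I. \<zero>\<^bsub>A\<^esub>),
     add = (\<lambda>X Y. \<lambda>p\<in>I. X p \<oplus>\<^bsub>A\<^esub> Y p),
     smult = (\<lambda>c X. \<lambda>p\<in>I. c \<odot>\<^bsub>A\<^esub> X p),
     star = (\<lambda>X. \<lambda>(i, j)\<in>I. star A (X (j, i)))\<rparr>)"

definition matrix_map :: "nat \<Rightarrow> ('a \<Rightarrow> 'b) \<Rightarrow> (nat \<times> nat \<Rightarrow> 'a) \<Rightarrow> (nat \<times> nat \<Rightarrow> 'b)" where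
  "matrix_map n f X = (\<lambda>p\<in>{..<n} \<times> {..<n}. f (X p))"

text \<open>
  Positivity in the pre-C*-algebra \<open>M\<^sub>n(A)\<close>, that is, \<open>M\<^sub>n \<otimes> A\<close>: the completion of \<open>M\<^sub>n(A)\<close> is
  \<open>M\<^sub>n\<close> of the completion of \<open>A\<close>. For \<open>n = 1\<close> this is positivity in \<open>A\<close>.
\<close>

definition positive_matrices :: "nat \<Rightarrow> 'a pre_cstar \<Rightarrow> (nat \<times> nat \<Rightarrow> 'a) set" where
  "positive_matrices n A =
    {X \<in> carrier (matrix_alg n A). \<exists>Y \<in> carrier (matrix_alg n (completion A)).
       matrix_map n (completion_emb A) X =
         star (matrix_alg n (completion A)) Y \<otimes>\<^bsub>matrix_alg n (completion A)\<^esub> Y}"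

definition unital_linear_maps ::
    "('a, 'm) star_alg_scheme \<Rightarrow> ('b, 'n) star_alg_scheme \<Rightarrow> ('a \<Rightarrow> 'b) set" where
  "unital_linear_maps A B =
    {f \<in> carrier A \<rightarrow>\<^sub>E carrier B.
       (\<forall>x\<in>carrier A. \<forall>y\<in>carrier A. f (x \<oplus>\<^bsub>A\<^esub> y) = f x \<oplus>\<^bsub>B\<^esub> f y) \<and>
       (\<forall>c. \<forall>x\<in>carrier A. f (c \<odot>\<^bsub>A\<^esub> x) = c \<odot>\<^bsub>B\<^esub> f x) \<and>
       f \<one>\<^bsub>A\<^esub> = \<one>\<^bsub>B\<^esub>}"

definition completely_positive :: "'a pre_cstar \<Rightarrow> 'b pre_cstar \<Rightarrow> ('a \<Rightarrow> 'b) \<Rightarrow> bool" where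
  "completely_positive A B f \<longleftrightarrow>
    (\<forall>n. \<forall>X \<in> positive_matrices n A. matrix_map n f X \<in> positive_matrices n B)"


section \<open>Tensor products\<close>

text \<open>
  The algebraic tensor product is the quotient of the free complex vector space on
  \<open>carrier A \<times> carrier B\<close>, realised by finitely supported functions, by the subspace
  \<open>tensor_null A B\<close> generated by the bilinearity relations.
\<close>

definition tensor_free ::
    "('a, 'm) star_alg_scheme \<Rightarrow> ('b, 'n) star_alg_scheme \<Rightarrow> ('a \<times> 'b \<Rightarrow>\<^sub>0 complex) set" where
  "tensor_free A B = {f. Poly_Mapping.keys f \<subseteq> carrier A \<times> carrier B}"

inductive_set tensor_null ::
    "('a, 'm) star_alg_scheme \<Rightarrow> ('b, 'n) star_alg_scheme \<Rightarrow> ('a \<times> 'b \<Rightarrow>\<^sub>0 complex) set"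
  for A :: "('a, 'm) star_alg_scheme" and B :: "('b, 'n) star_alg_scheme" where
  zero: "0 \<in> tensor_null A B"
| add: "f \<in> tensor_null A B \<Longrightarrow> g \<in> tensor_null A B \<Longrightarrow> f + g \<in> tensor_null A B"
| scale: "f \<in> tensor_null A B \<Longrightarrow> Poly_Mapping.map ((*) c) f \<in> tensor_null A B"
| add_left: "a \<in> carrier A \<Longrightarrow> a' \<in> carrier A \<Longrightarrow> b \<in> carrier B \<Longrightarrow>
    Poly_Mapping.single (a \<oplus>\<^bsub>A\<^esub> a', b) 1 - Poly_Mapping.single (a, b) 1
      - Poly_Mapping.single (a', b) 1 \<in> tensor_null A B"
| add_right: "a \<in> carrier A \<Longrightarrow> b \<in> carrier B \<Longrightarrow> b' \<in> carrier B \<Longrightarrow>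
    Poly_Mapping.single (a, b \<oplus>\<^bsub>B\<^esub> b') 1 - Poly_Mapping.single (a, b) 1
      - Poly_Mapping.single (a, b') 1 \<in> tensor_null A B"
| smult_left: "a \<in> carrier A \<Longrightarrow> b \<in> carrier B \<Longrightarrow>
    Poly_Mapping.single (c \<odot>\<^bsub>A\<^esub> a, b) 1 - Poly_Mapping.single (a, b) c \<in> tensor_null A B"
| smult_right: "a \<in> carrier A \<Longrightarrow> b \<in> carrier B \<Longrightarrow>
    Poly_Mapping.single (a, c \<odot>\<^bsub>B\<^esub> b) 1 - Poly_Mapping.single (a, b) c \<in> tensor_null A B"

definition tensor_rel ::
    "('a, 'm) star_alg_scheme \<Rightarrow> ('b, 'n) star_alg_scheme \<Rightarrow>
     (('a \<times> 'b \<Rightarrow>\<^sub>0 complex) \<times> ('a \<times> 'b \<Rightarrow>\<^sub>0 complex)) set" where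
  "tensor_rel A B =
    {(f, g). f \<in> tensor_free A B \<and> g \<in> tensor_free A B \<and> f - g \<in> tensor_null A B}"

definition pure_tensor ::
    "('a, 'm) star_alg_scheme \<Rightarrow> ('b, 'n) star_alg_scheme \<Rightarrow> 'a \<Rightarrow> 'b \<Rightarrow>
     ('a \<times> 'b \<Rightarrow>\<^sub>0 complex) set" where
  "pure_tensor A B a b = tensor_rel A B `` {Poly_Mapping.single (a, b) 1}"

definition alg_tensor ::
    "('a, 'm) star_alg_scheme \<Rightarrow> ('b, 'n) star_alg_scheme \<Rightarrow>
     ('a \<times> 'b \<Rightarrow>\<^sub>0 complex) set star_alg" where
  "alg_tensor A B =
    \<lparr>carrier = tensor_free A B // tensor_rel A B,
     mult = (\<lambda>X Y. \<Union>f\<in>X. \<Union>g\<in>Y. tensor_rel A B ``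
       {\<Sum>(a, b)\<in>Poly_Mapping.keys f. \<Sum>(a', b')\<in>Poly_Mapping.keys g.
          Poly_Mapping.single (a \<otimes>\<^bsub>A\<^esub> a', b \<otimes>\<^bsub>B\<^esub> b')
            (Poly_Mapping.lookup f (a, b) * Poly_Mapping.lookup g (a', b'))}),
     one = pure_tensor A B \<one>\<^bsub>A\<^esub> \<one>\<^bsub>B\<^esub>,
     zero = tensor_rel A B `` {0},
     add = (\<lambda>X Y. \<Union>f\<in>X. \<Union>g\<in>Y. tensor_rel A B `` {f + g}),
     smult = (\<lambda>c X. \<Union>f\<in>X. tensor_rel A B `` {Poly_Mapping.map ((*) c) f}),
     star = (\<lambda>X. \<Union>f\<in>X. tensor_rel A B ``
       {\<Sum>(a, b)\<in>Poly_Mapping.keys f.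
          Poly_Mapping.single (star A a, star B b) (cnj (Poly_Mapping.lookup f (a, b)))})\<rparr>"

text \<open>The linear map \<open>a \<otimes> b \<mapsto> f a \<otimes> g b\<close> from \<open>A \<odot> B\<close> to \<open>C \<odot> D\<close>, for linear \<open>f\<close> and \<open>g\<close>.\<close>

definition tensor_map ::
    "('c, 'm) star_alg_scheme \<Rightarrow> ('d, 'n) star_alg_scheme \<Rightarrow> ('a \<Rightarrow> 'c) \<Rightarrow> ('b \<Rightarrow> 'd) \<Rightarrow>
     ('a \<times> 'b \<Rightarrow>\<^sub>0 complex) set \<Rightarrow> ('c \<times> 'd \<Rightarrow>\<^sub>0 complex) set" where
  "tensor_map C D f g X = (\<Union>r\<in>X. tensor_rel C D ``
     {\<Sum>(a, b)\<in>Poly_Mapping.keys r.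
        Poly_Mapping.single (f a, g b) (Poly_Mapping.lookup r (a, b))})"

text \<open>The linear map \<open>a \<otimes> b \<mapsto> a b\<close> from \<open>A \<odot> A\<close> to \<open>A\<close>.\<close>

definition mult_map ::
    "('a, 'm) star_alg_scheme \<Rightarrow> ('a \<times> 'a \<Rightarrow>\<^sub>0 complex) set \<Rightarrow> 'a" where
  "mult_map A X = the_elem ((\<lambda>r. \<Oplus>\<^bsub>A\<^esub>p\<in>Poly_Mapping.keys r.
     Poly_Mapping.lookup r p \<odot>\<^bsub>A\<^esub> (fst p \<otimes>\<^bsub>A\<^esub> snd p)) ` X)"

text \<open>
  For C*-algebras \<open>E\<close>, \<open>F\<close> the norms of \<open>E \<otimes>\<^sub>m\<^sub>i\<^sub>n F\<close> and \<open>E \<otimes>\<^sub>m\<^sub>a\<^sub>x F\<close> are the least and the greatest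
  C*-norm on the algebraic tensor product. (The least one is the spatial norm.)
\<close>

datatype tensor_kind = Min_Tensor | Max_Tensor

definition cstar_norms :: "'a star_alg \<Rightarrow> ('a \<Rightarrow> real) set" where
  "cstar_norms S = {p. pre_cstar_algebra (with_nrm S p)}"

fun cstar_tensor_norm ::
    "tensor_kind \<Rightarrow> 'a pre_cstar \<Rightarrow> 'b pre_cstar \<Rightarrow> ('a \<times> 'b \<Rightarrow>\<^sub>0 complex) set \<Rightarrow> real" where
  "cstar_tensor_norm Min_Tensor E F X = (INF p\<in>cstar_norms (alg_tensor E F). p X)"
| "cstar_tensor_norm Max_Tensor E F X = (SUP p\<in>cstar_norms (alg_tensor E F). p X)"

definition tensor :: "tensor_kind \<Rightarrow> 'a pre_cstar \<Rightarrow> 'b pre_cstar \<Rightarrow>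
    ('a \<times> 'b \<Rightarrow>\<^sub>0 complex) set pre_cstar" where
  "tensor t A B = with_nrm (alg_tensor A B)
     (\<lambda>X. cstar_tensor_norm t (completion A) (completion B)
        (tensor_map (completion A) (completion B) (completion_emb A) (completion_emb B) X))"


section \<open>The categories\<close>

text \<open>An arrow from \<open>A\<close> to \<open>B\<close> carries its opposite, a function from \<open>B\<close> to \<open>A\<close>.\<close>

record ('a, 'b) arrow =
  source :: "'a pre_cstar"
  target :: "'b pre_cstar"
  opp :: "'b \<Rightarrow> 'a"

text \<open>
  The hom-sets are the same for both choices of the monoidal product. Unital linear maps are not
  assumed to be bounded.
\<close>

definition gen_hom :: "'a pre_cstar \<Rightarrow> 'b pre_cstar \<Rightarrow> ('a, 'b) arrow set" where
  "gen_hom A B = {\<omega>. pre_cstar_algebra A \<and> pre_cstar_algebra B \<and>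
     source \<omega> = A \<and> target \<omega> = B \<and> opp \<omega> \<in> unital_linear_maps B A}"

definition cpu_hom :: "'a pre_cstar \<Rightarrow> 'b pre_cstar \<Rightarrow> ('a, 'b) arrow set" where
  "cpu_hom A B = {\<omega> \<in> gen_hom A B. completely_positive B A (opp \<omega>)}"

definition arr_id :: "'a pre_cstar \<Rightarrow> ('a, 'a) arrow" where
  "arr_id A = \<lparr>source = A, target = A, opp = (\<lambda>x\<in>carrier A. x)\<rparr>"

definition arr_comp :: "('b, 'c) arrow \<Rightarrow> ('a, 'b) arrow \<Rightarrow> ('a, 'c) arrow" (infixr "\<cdot>" 70) where
  "\<psi> \<cdot> \<phi> = \<lparr>source = source \<phi>, target = target \<psi>,
     opp = compose (carrier (target \<psi>)) (opp \<phi>) (opp \<psi>)\<rparr>"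

definition arr_tensor :: "tensor_kind \<Rightarrow> ('a, 'c) arrow \<Rightarrow> ('b, 'd) arrow \<Rightarrow>
    (('a \<times> 'b \<Rightarrow>\<^sub>0 complex) set, ('c \<times> 'd \<Rightarrow>\<^sub>0 complex) set) arrow" where
  "arr_tensor t \<phi> \<psi> =
    \<lparr>source = tensor t (source \<phi>) (source \<psi>), target = tensor t (target \<phi>) (target \<psi>),
     opp = (\<lambda>X\<in>carrier (tensor t (target \<phi>) (target \<psi>)).
       tensor_map (source \<phi>) (source \<psi>) (opp \<phi>) (opp \<psi>) X)\<rparr>"

definition copy :: "tensor_kind \<Rightarrow> 'a pre_cstar \<Rightarrow> ('a, ('a \<times> 'a \<Rightarrow>\<^sub>0 complex) set) arrow" where
  "copy t A = \<lparr>source = A, target = tensor t A A,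
     opp = (\<lambda>X\<in>carrier (tensor t A A). mult_map A X)\<rparr>"

text \<open>The threefold monoidal product is bracketed as \<open>(A \<odot> A) \<odot> A\<close>.\<close>

definition copy3 :: "tensor_kind \<Rightarrow> 'a pre_cstar \<Rightarrow>
    ('a, (('a \<times> 'a \<Rightarrow>\<^sub>0 complex) set \<times> 'a \<Rightarrow>\<^sub>0 complex) set) arrow" where
  "copy3 t A = arr_tensor t (copy t A) (arr_id A) \<cdot> copy t A"


section \<open>Almost sure equality and nullspaces\<close>

definition left_ase ::
    "tensor_kind \<Rightarrow> ('a, 'b) arrow \<Rightarrow> ('b, 'c) arrow \<Rightarrow> ('b, 'c) arrow \<Rightarrow> bool" where
  "left_ase t \<omega> \<phi> \<psi> \<longleftrightarrow> (let B = target \<omega> in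
     arr_tensor t \<phi> (arr_id B) \<cdot> copy t B \<cdot> \<omega> = arr_tensor t \<psi> (arr_id B) \<cdot> copy t B \<cdot> \<omega>)"

definition right_ase ::
    "tensor_kind \<Rightarrow> ('a, 'b) arrow \<Rightarrow> ('b, 'c) arrow \<Rightarrow> ('b, 'c) arrow \<Rightarrow> bool" where
  "right_ase t \<omega> \<phi> \<psi> \<longleftrightarrow> (let B = target \<omega> in
     arr_tensor t (arr_id B) \<phi> \<cdot> copy t B \<cdot> \<omega> = arr_tensor t (arr_id B) \<psi> \<cdot> copy t B \<cdot> \<omega>)"

definition symmetric_ase ::
    "tensor_kind \<Rightarrow> ('a, 'b) arrow \<Rightarrow> ('b, 'c) arrow \<Rightarrow> ('b, 'c) arrow \<Rightarrow> bool" where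
  "symmetric_ase t \<omega> \<phi> \<psi> \<longleftrightarrow> (let B = target \<omega> in
     arr_tensor t (arr_tensor t (arr_id B) \<phi>) (arr_id B) \<cdot> copy3 t B \<cdot> \<omega> =
     arr_tensor t (arr_tensor t (arr_id B) \<psi>) (arr_id B) \<cdot> copy3 t B \<cdot> \<omega>)"

definition left_nullspace :: "('a, 'b) arrow \<Rightarrow> 'b set" where
  "left_nullspace \<omega> = (let A = source \<omega>; B = target \<omega> in
     {x \<in> carrier B. opp \<omega> (x \<otimes>\<^bsub>B\<^esub> star B x) = \<zero>\<^bsub>A\<^esub>})"

definition right_nullspace :: "('a, 'b) arrow \<Rightarrow> 'b set" where
  "right_nullspace \<omega> = (let A = source \<omega>; B = target \<omega> in
     {x \<in> carrier B. opp \<omega> (star B x \<otimes>\<^bsub>B\<^esub> x) = \<zero>\<^bsub>A\<^esub>})"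

definition symmetric_nullspace :: "('a, 'b) arrow \<Rightarrow> 'b set" where
  "symmetric_nullspace \<omega> = (let A = source \<omega>; B = target \<omega> in
     {x \<in> carrier B. \<forall>y\<in>carrier B.
        opp \<omega> (star B y \<otimes>\<^bsub>B\<^esub> star B x \<otimes>\<^bsub>B\<^esub> x \<otimes>\<^bsub>B\<^esub> y) = \<zero>\<^bsub>A\<^esub>})"

end

theory Submission
  imports Defs
begin

text \<open>
  The hom-sets do not see the norm on a tensor product: two arrows into the same target agree as
  soon as their opposites agree as functions, and linear functions on an algebraic tensor product
  agree as soon as they agree on elementary tensors (\<open>linear_between_eqI\<close>). Hence both
  choices of tensor product give the same answer, and with \<open>d y = \<phi> y - \<psi> y\<close> (opposites
  understood) the three almost sure equalities say that \<open>\<omega> (d y b) = 0\<close>, that \<open>\<omega> (b d y) = 0\<close>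
  and that \<open>\<omega> (b d y b') = 0\<close>, for all \<open>y\<close>, \<open>b\<close>, \<open>b'\<close> (\<open>arr_tensor_copy_eq_iff\<close>,
  \<open>arr_tensor_copy3_eq_iff\<close>).

  Specialising \<open>b\<close> to an adjoint gives the three nullspace conditions. The converse is the
  degenerate case of the Cauchy-Schwarz inequality (\<open>cp_null_cross_terms\<close>): if
  \<open>\<omega> (x* x) = 0\<close> then \<open>\<omega> (x* b) = \<omega> (b* x) = 0\<close>. To see it, expand
  \<open>\<omega> ((x + \<lambda> b)* (x + \<lambda> b)) = \<lambda> \<omega> (x* b) + cnj \<lambda> \<omega> (b* x) + |\<lambda>|\<^sup>2 \<omega> (b* b)\<close>. The values at \<open>\<lambda>\<close> and
  \<open>-\<lambda>\<close> are positive and their sum has order \<open>|\<lambda>|\<^sup>2\<close>. If a positive element is bounded by the sum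
  with another positive element, each of them has order \<open>|\<lambda>|\<^sup>2\<close>, so the terms linear in \<open>\<lambda>\<close>
  vanish.

  It remains to bound \<open>a* a\<close> by \<open>a* a + b* b\<close> in norm (\<open>nrm_star_square_le_sum\<close>); this is the
  analytic core. It is the theorem of Fukamiya, Kaplansky, Kelley and Vaught that \<open>a* a\<close> is
  positive, in a quantitative form with the constant \<open>20\<close>, which is not optimal. A norm estimate
  can be proved in the incomplete algebra, without spectra and functional calculus, and it passes
  to positive elements of the completion, because these are limits of elements \<open>z* z\<close> with \<open>z\<close> in
  the algebra itself (\<open>positive_approx_star_square\<close>). The single analytic tool is an
  approximate square root of \<open>1 - q\<close>, polynomial in \<open>q\<close>, for self-adjoint \<open>q\<close> of norm less than \<open>1\<close>
  (\<open>approx_sqrt_one_minus\<close>).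
\<close>

section \<open>Calculation in unital complex *-algebras\<close>

context star_algebra begin

lemma smult_closed' [simp, intro]: "x \<in> carrier A \<Longrightarrow> c \<odot> x \<in> carrier A"
  by (rule smult_closed) (auto simp: complex_ring_def)

lemma smult_add_scalar: "x \<in> carrier A \<Longrightarrow> (c + d) \<odot> x = c \<odot> x \<oplus> d \<odot> x"
  using smult_l_distr[of c d x] by (simp add: complex_ring_def)

lemma smult_add: "x \<in> carrier A \<Longrightarrow> y \<in> carrier A \<Longrightarrow> c \<odot> (x \<oplus> y) = c \<odot> x \<oplus> c \<odot> y"
  using smult_r_distr[of c x y] by (simp add: complex_ring_def)

lemma smult_smult: "x \<in> carrier A \<Longrightarrow> c \<odot> (d \<odot> x) = (c * d) \<odot> x"
  using smult_assoc1[of c d x] by (simp add: complex_ring_def)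

lemma smult_1 [simp]: "x \<in> carrier A \<Longrightarrow> 1 \<odot> x = x"
  using smult_one[of x] by (simp add: complex_ring_def)

lemma smult_0 [simp]: "x \<in> carrier A \<Longrightarrow> 0 \<odot> x = \<zero>"
  using smult_l_null[of x] by (simp add: complex_ring_def)

lemma smult_zero [simp]: "c \<odot> \<zero> = \<zero>"
  using smult_r_null[of c] by (simp add: complex_ring_def)

lemma neg_eq_smult:
  assumes "x \<in> carrier A"
  shows "\<ominus> x = (- 1) \<odot> x"
proof (rule minus_equality)
  show "(- 1) \<odot> x \<oplus> x = \<zero>"
    using smult_add_scalar[OF assms, of "- 1" 1] assms by simp
qed (use assms in auto)

lemma minus_eq_smult: "x \<in> carrier A \<Longrightarrow> y \<in> carrier A \<Longrightarrow> x \<ominus> y = x \<oplus> (- 1) \<odot> y"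
  by (simp add: minus_eq neg_eq_smult)

text \<open>
  Together with \<open>expand_simps\<close> and \<open>a_ac\<close> these rules normalise noncommutative
  polynomials with complex coefficients: multiply out, move all scalars to the front, and collect
  equal monomials. The last two rules reach over one summand, because the term order need not
  place \<open>x\<close> and \<open>d \<odot> x\<close> next to each other.
\<close>

lemma smult_collect:
  "x \<in> carrier A \<Longrightarrow> y \<in> carrier A \<Longrightarrow> c \<odot> x \<oplus> (d \<odot> x \<oplus> y) = (c + d) \<odot> x \<oplus> y"
  "x \<in> carrier A \<Longrightarrow> y \<in> carrier A \<Longrightarrow> x \<oplus> (d \<odot> x \<oplus> y) = (1 + d) \<odot> x \<oplus> y"
  "x \<in> carrier A \<Longrightarrow> y \<in> carrier A \<Longrightarrow> c \<odot> x \<oplus> (x \<oplus> y) = (c + 1) \<odot> x \<oplus> y"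
  "x \<in> carrier A \<Longrightarrow> y \<in> carrier A \<Longrightarrow> x \<oplus> (x \<oplus> y) = 2 \<odot> x \<oplus> y"
  "x \<in> carrier A \<Longrightarrow> c \<odot> x \<oplus> d \<odot> x = (c + d) \<odot> x"
  "x \<in> carrier A \<Longrightarrow> x \<oplus> d \<odot> x = (1 + d) \<odot> x"
  "x \<in> carrier A \<Longrightarrow> c \<odot> x \<oplus> x = (c + 1) \<odot> x"
  "x \<in> carrier A \<Longrightarrow> x \<oplus> x = 2 \<odot> x"
  "x \<in> carrier A \<Longrightarrow> y \<in> carrier A \<Longrightarrow> z \<in> carrier A \<Longrightarrow> x \<oplus> (z \<oplus> (d \<odot> x \<oplus> y)) = z \<oplus> ((1 + d) \<odot> x \<oplus> y)"
  "x \<in> carrier A \<Longrightarrow> y \<in> carrier A \<Longrightarrow> x \<oplus> (y \<oplus> d \<odot> x) = y \<oplus> (1 + d) \<odot> x"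
  using smult_add_scalar[of x 1 1]
  by (simp_all add: smult_add_scalar a_ac)

lemmas expand_simps = minus_eq_smult neg_eq_smult l_distr r_distr m_assoc smult_mult_left smult_mult_right
  smult_add smult_smult a_assoc star_add star_smult star_mult star_star

lemma minus_eq_zero_iff:
  assumes "x \<in> carrier A" "y \<in> carrier A"
  shows "x \<ominus> y = \<zero> \<longleftrightarrow> x = y"
proof -
  have "x = (x \<ominus> y) \<oplus> y"
    using assms by (simp add: expand_simps a_ac smult_collect)
  then show ?thesis
    using assms by (metis l_zero minus_eq r_neg)
qed

lemma star_one [simp]: "star A \<one> = \<one>"
proof -
  have "star A \<one> = star A \<one> \<otimes> star A (star A \<one>)"
    by (simp add: star_star star_closed)
  also have "\<dots> = star A (star A \<one>)"
    by (subst star_mult[symmetric]) (simp_all add: star_closed)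
  finally show ?thesis by (simp add: star_star)
qed

lemma star_minus: "x \<in> carrier A \<Longrightarrow> y \<in> carrier A \<Longrightarrow> star A (x \<ominus> y) = star A x \<ominus> star A y"
  by (simp add: expand_simps star_closed)


definition self_adjoint :: "'a \<Rightarrow> bool" where
  "self_adjoint x \<longleftrightarrow> x \<in> carrier A \<and> star A x = x"

lemma self_adjoint_closed [simp, intro]: "self_adjoint x \<Longrightarrow> x \<in> carrier A"
  by (simp add: self_adjoint_def)

lemma self_adjoint_star: "self_adjoint x \<Longrightarrow> star A x = x"
  by (simp add: self_adjoint_def)

lemma self_adjoint_one: "self_adjoint \<one>"
  by (simp add: self_adjoint_def)

lemma self_adjoint_smult: "self_adjoint x \<Longrightarrow> self_adjoint (of_real c \<odot> x)"
  by (auto simp: self_adjoint_def star_smult)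

lemma self_adjoint_add: "self_adjoint x \<Longrightarrow> self_adjoint y \<Longrightarrow> self_adjoint (x \<oplus> y)"
  by (auto simp: self_adjoint_def star_add)

lemma self_adjoint_minus: "self_adjoint x \<Longrightarrow> self_adjoint y \<Longrightarrow> self_adjoint (x \<ominus> y)"
  by (auto simp: self_adjoint_def star_minus)

lemma self_adjoint_mult:
  "self_adjoint x \<Longrightarrow> self_adjoint y \<Longrightarrow> x \<otimes> y = y \<otimes> x \<Longrightarrow> self_adjoint (x \<otimes> y)"
  by (auto simp: self_adjoint_def star_mult)

lemma self_adjoint_star_mult: "x \<in> carrier A \<Longrightarrow> self_adjoint (star A x \<otimes> x)"
  by (simp add: self_adjoint_def star_mult star_closed star_star)

text \<open>
  If \<open>y = sqrt_iter q n\<close> were a fixed point, then \<open>2 y = q + y\<^sup>2\<close>, that is, \<open>(1 - y)\<^sup>2 = 1 - q\<close>.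
\<close>

primrec sqrt_iter :: "'a \<Rightarrow> nat \<Rightarrow> 'a" where
  "sqrt_iter q 0 = \<zero>"
| "sqrt_iter q (Suc n) = (1/2) \<odot> (q \<oplus> sqrt_iter q n \<otimes> sqrt_iter q n)"

lemma sqrt_iter_closed [simp, intro]: "q \<in> carrier A \<Longrightarrow> sqrt_iter q n \<in> carrier A"
  by (induction n) auto

lemma star_zero [simp]: "star A \<zero> = \<zero>"
  using star_smult[of \<zero> 0] by (simp add: star_closed)

lemma sqrt_iter_self_adjoint:
  assumes q: "self_adjoint q"
  shows "self_adjoint (sqrt_iter q n)"
proof (induction n)
  case (Suc n)
  have "self_adjoint (complex_of_real (1 / 2) \<odot> (q \<oplus> sqrt_iter q n \<otimes> sqrt_iter q n))"
    by (intro self_adjoint_smult self_adjoint_add self_adjoint_mult q Suc refl)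
  then show ?case by simp
qed (simp add: self_adjoint_def)

lemma sqrt_iter_commute:
  assumes "q \<in> carrier A" "z \<in> carrier A" "z \<otimes> q = q \<otimes> z"
  shows "z \<otimes> sqrt_iter q n = sqrt_iter q n \<otimes> z"
proof (induction n)
  case (Suc n)
  let ?y = "sqrt_iter q n"
  have y: "?y \<in> carrier A" using assms by auto
  have "z \<otimes> (?y \<otimes> ?y) = (z \<otimes> ?y) \<otimes> ?y"
    using y assms by (simp only: m_assoc)
  also have "\<dots> = ?y \<otimes> (z \<otimes> ?y)"
    using y assms by (simp only: Suc m_assoc)
  also have "\<dots> = (?y \<otimes> ?y) \<otimes> z"
    using y assms by (simp only: Suc m_assoc)
  finally have "z \<otimes> (?y \<otimes> ?y) = (?y \<otimes> ?y) \<otimes> z" .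
  then show ?case
    using assms by (simp add: smult_mult_left smult_mult_right l_distr r_distr)
qed (use assms in simp)

lemma diff_squares_commuting:
  assumes "x \<in> carrier A" "y \<in> carrier A" "x \<otimes> y = y \<otimes> x"
  shows "x \<otimes> x \<ominus> y \<otimes> y = (x \<ominus> y) \<otimes> (x \<oplus> y)"
  using assms by (simp add: expand_simps a_ac smult_collect)

lemma star_mult_complex_combination:
  assumes "self_adjoint x" "self_adjoint y" "x \<otimes> y = y \<otimes> x"
  shows "star A (x \<oplus> \<i> \<odot> y) \<otimes> (x \<oplus> \<i> \<odot> y) = x \<otimes> x \<oplus> y \<otimes> y"
  using assms(3) self_adjoint_closed[OF assms(1)] self_adjoint_closed[OF assms(2)]
  by (simp add: expand_simps a_ac smult_collect assms(1,2)[THEN self_adjoint_star])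

end

section \<open>Approximate square roots in a pre-C*-algebra\<close>

context pre_cstar_algebra begin

lemma nrm_zero [simp]: "nrm A \<zero> = 0"
  by (simp add: nrm_eq_0_iff)

lemma nrm_minus_triangle:
  "x \<in> carrier A \<Longrightarrow> y \<in> carrier A \<Longrightarrow> nrm A (x \<ominus> y) \<le> nrm A x + nrm A y"
  using nrm_triangle[of x "(- 1) \<odot> y"] by (simp add: minus_eq_smult nrm_smult)

lemma nrm_minus_commute:
  assumes "x \<in> carrier A" "y \<in> carrier A"
  shows "nrm A (x \<ominus> y) = nrm A (y \<ominus> x)"
proof -
  have "x \<ominus> y = (- 1) \<odot> (y \<ominus> x)"
    using assms by (simp add: expand_simps a_ac)
  then show ?thesis
    using assms by (simp add: nrm_smult)
qed

lemma nrm_dist_triangle: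
  assumes "x \<in> carrier A" "y \<in> carrier A" "z \<in> carrier A"
  shows "nrm A (x \<ominus> z) \<le> nrm A (x \<ominus> y) + nrm A (y \<ominus> z)"
proof -
  have "x \<ominus> z = (x \<ominus> y) \<oplus> (y \<ominus> z)"
    using assms by (simp add: expand_simps a_ac smult_collect)
  then show ?thesis
    using assms nrm_triangle[of "x \<ominus> y" "y \<ominus> z"] by simp
qed

lemma nrm_le_add_dist:
  assumes "x \<in> carrier A" "y \<in> carrier A"
  shows "nrm A x \<le> nrm A y + nrm A (x \<ominus> y)"
proof -
  have "x = y \<oplus> (x \<ominus> y)"
    using assms by (simp add: expand_simps a_ac smult_collect)
  then show ?thesis
    using assms nrm_triangle[of y "x \<ominus> y"] by simp
qed

lemma nrm_star:
  assumes "x \<in> carrier A"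
  shows "nrm A (star A x) = nrm A x"
proof -
  have le: "nrm A y \<le> nrm A (star A y)" if y: "y \<in> carrier A" for y
  proof -
    have "nrm A y * nrm A y \<le> nrm A (star A y) * nrm A y"
      using nrm_mult[of "star A y" y] nrm_star_mult[of y] y
      by (simp add: star_closed power2_eq_square)
    then show ?thesis
      using nrm_nonneg[of y] nrm_nonneg[of "star A y"] y
      by (cases "nrm A y = 0") (auto simp: star_closed)
  qed
  show ?thesis
    using le[OF assms] le[OF star_closed[OF assms]] assms by (simp add: star_star)
qed

lemma nrm_one_le: "nrm A \<one> \<le> 1"
proof -
  have "nrm A \<one> = nrm A \<one> * nrm A \<one>"
    using nrm_star_mult[of \<one>] by (simp add: power2_eq_square)
  then show ?thesis
    by (metis mult_cancel_left1 order_refl zero_le_one)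
qed

lemma nrm_smult_one_le: "nrm A (c \<odot> \<one>) \<le> cmod c"
  using nrm_one_le by (simp add: nrm_smult mult_left_le)

lemma nrm_square:
  "self_adjoint x \<Longrightarrow> nrm A (x \<otimes> x) = (nrm A x)\<^sup>2"
  using nrm_star_mult[of x] by (simp add: self_adjoint_def)

text \<open>
  With \<open>u = x + i r\<close> the C*-identity gives \<open>nrm (x\<^sup>2 + r\<^sup>2) = (nrm u)\<^sup>2\<close>, and \<open>x\<close> is the real part of \<open>u\<close>.
\<close>

lemma nrm_square_le_sum_squares:
  assumes x: "self_adjoint x" and r: "self_adjoint r" and comm: "x \<otimes> r = r \<otimes> x"
  shows "(nrm A x)\<^sup>2 \<le> nrm A (x \<otimes> x \<oplus> r \<otimes> r)"
proof -
  define u where "u = x \<oplus> \<i> \<odot> r"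
  have u: "u \<in> carrier A"
    using x r by (auto simp: u_def)
  have "2 \<odot> x = u \<oplus> star A u"
    using self_adjoint_closed[OF x] self_adjoint_closed[OF r]
    by (simp add: u_def expand_simps a_ac smult_collect x[THEN self_adjoint_star] r[THEN self_adjoint_star])
  then have "nrm A (2 \<odot> x) \<le> 2 * nrm A u"
    using nrm_triangle[of u "star A u"] u by (simp add: nrm_star star_closed)
  then have "nrm A x \<le> nrm A u"
    using x by (simp add: nrm_smult self_adjoint_closed)
  then have "(nrm A x)\<^sup>2 \<le> (nrm A u)\<^sup>2"
    using x by (simp add: power_mono nrm_nonneg self_adjoint_closed)
  also have "\<dots> = nrm A (x \<otimes> x \<oplus> r \<otimes> r)"
    using nrm_star_mult[OF u] star_mult_complex_combination[OF x r comm] by (simp add: u_def)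
  finally show ?thesis .
qed

lemma nrm_sqrt_iter:
  assumes q: "q \<in> carrier A" and t: "nrm A q \<le> t" "t \<le> 1"
  shows "nrm A (sqrt_iter q n) \<le> t"
proof (induction n)
  case 0
  then show ?case using nrm_nonneg[OF q] t by simp
next
  case (Suc n)
  let ?y = "sqrt_iter q n"
  have t0: "0 \<le> t" using nrm_nonneg[OF q] t by simp
  have "nrm A (?y \<otimes> ?y) \<le> t * t"
    using nrm_mult[of ?y ?y] Suc q by (smt (verit) mult_mono nrm_nonneg sqrt_iter_closed t0)
  also have "\<dots> \<le> t"
    using t t0 by (simp add: mult_left_le)
  finally have "nrm A (q \<oplus> ?y \<otimes> ?y) \<le> 2 * t"
    using nrm_triangle[of q "?y \<otimes> ?y"] q t by simp
  then show ?case
    using q by (simp add: nrm_smult)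
qed

text \<open>
  Consecutive iterates commute, so \<open>y'\<^sup>2 - y\<^sup>2 = (y' - y) (y' + y)\<close>; the iteration therefore
  contracts distances by the factor \<open>t\<close>, the common norm bound of the iterates.
\<close>

lemma nrm_sqrt_iter_step:
  assumes q: "q \<in> carrier A" and t: "nrm A q \<le> t" "t \<le> 1"
  shows "nrm A (sqrt_iter q (Suc n) \<ominus> sqrt_iter q n) \<le> t ^ n"
proof (induction n)
  case 0
  then show ?case
    using nrm_sqrt_iter[OF q t, of 1] t q by (simp add: minus_eq)
next
  case (Suc n)
  let ?x = "sqrt_iter q (Suc n)" and ?y = "sqrt_iter q n"
  have c: "?x \<in> carrier A" "?y \<in> carrier A" using q by (auto simp del: sqrt_iter.simps)
  have t0: "0 \<le> t" using nrm_nonneg[OF q] t by simp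
  have comm: "?x \<otimes> ?y = ?y \<otimes> ?x"
    using q sqrt_iter_commute[OF q q refl] by (intro sqrt_iter_commute) (auto simp del: sqrt_iter.simps)
  have "sqrt_iter q (Suc (Suc n)) \<ominus> ?x = (1/2) \<odot> (q \<oplus> ?x \<otimes> ?x) \<ominus> (1/2) \<odot> (q \<oplus> ?y \<otimes> ?y)"
    by simp
  also have "\<dots> = (1/2) \<odot> (?x \<otimes> ?x \<ominus> ?y \<otimes> ?y)"
    using c q by (simp add: expand_simps a_ac smult_collect del: sqrt_iter.simps)
  also have "\<dots> = (1/2) \<odot> ((?x \<ominus> ?y) \<otimes> (?x \<oplus> ?y))"
    using diff_squares_commuting[OF c comm] by simp
  finally have eq: "nrm A (sqrt_iter q (Suc (Suc n)) \<ominus> ?x) = nrm A ((?x \<ominus> ?y) \<otimes> (?x \<oplus> ?y)) / 2"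
    using c by (simp add: nrm_smult del: sqrt_iter.simps)
  have "nrm A (?x \<oplus> ?y) \<le> 2 * t"
    using nrm_triangle[OF c] nrm_sqrt_iter[OF q t, of n] nrm_sqrt_iter[OF q t, of "Suc n"] by linarith
  then have "nrm A (?x \<ominus> ?y) * nrm A (?x \<oplus> ?y) \<le> t ^ n * (2 * t)"
    using Suc c by (intro mult_mono) (auto simp: nrm_nonneg t0 simp del: sqrt_iter.simps)
  moreover have "nrm A ((?x \<ominus> ?y) \<otimes> (?x \<oplus> ?y)) \<le> nrm A (?x \<ominus> ?y) * nrm A (?x \<oplus> ?y)"
    using c by (intro nrm_mult) auto
  ultimately have "nrm A ((?x \<ominus> ?y) \<otimes> (?x \<oplus> ?y)) / 2 \<le> t ^ n * (2 * t) / 2"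
    by linarith
  then show ?case
    unfolding eq by (simp add: mult.commute del: sqrt_iter.simps)
qed

text \<open>
  For \<open>w = 1 - y\<close> with an iterate \<open>y\<close>, the defect \<open>1 - q - w\<^sup>2\<close> is \<open>-2\<close> times the next step of the
  iteration. As a polynomial in \<open>q\<close>, \<open>w\<close> commutes with whatever commutes with \<open>q\<close>.
\<close>

lemma approx_sqrt_one_minus:
  assumes q: "self_adjoint q" and t: "nrm A q \<le> t" "t < 1" and d: "0 < d"
  shows "\<exists>w. self_adjoint w \<and> nrm A (\<one> \<ominus> q \<ominus> w \<otimes> w) \<le> d \<and>
    (\<forall>z\<in>carrier A. z \<otimes> q = q \<otimes> z \<longrightarrow> z \<otimes> w = w \<otimes> z)"
proof -
  have qc: "q \<in> carrier A" using q by auto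
  have t0: "0 \<le> t" using nrm_nonneg[OF qc] t by simp
  obtain n where n: "t ^ n < d / 2"
    using real_arch_pow_inv[of "d / 2" t] d t by auto
  define y where "y = sqrt_iter q n"
  have y: "self_adjoint y" "y \<in> carrier A"
    using sqrt_iter_self_adjoint[OF q] qc by (auto simp: y_def)
  show ?thesis
  proof (intro exI conjI ballI impI)
    show "self_adjoint (\<one> \<ominus> y)"
      using y by (simp add: self_adjoint_def star_minus)
    have "\<one> \<ominus> q \<ominus> (\<one> \<ominus> y) \<otimes> (\<one> \<ominus> y) = (- 2) \<odot> (sqrt_iter q (Suc n) \<ominus> y)"
      using y qc by (simp add: expand_simps a_ac smult_collect flip: y_def)
    then show "nrm A (\<one> \<ominus> q \<ominus> (\<one> \<ominus> y) \<otimes> (\<one> \<ominus> y)) \<le> d"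
      using nrm_sqrt_iter_step[OF qc t(1), of n] t n qc y
      by (simp add: nrm_smult y_def del: sqrt_iter.simps)
    show "z \<otimes> (\<one> \<ominus> y) = (\<one> \<ominus> y) \<otimes> z" if "z \<in> carrier A" "z \<otimes> q = q \<otimes> z" for z
      using sqrt_iter_commute[OF qc that, of n] that y by (simp add: y_def expand_simps)
  qed
qed

end

section \<open>Squares of self-adjoint elements\<close>

context pre_cstar_algebra begin

lemma nrm_smult_real: "x \<in> carrier A \<Longrightarrow> nrm A (complex_of_real c \<odot> x) = \<bar>c\<bar> * nrm A x"
  by (simp add: nrm_smult)

text \<open>
  Approximately, \<open>1 - s\<^sup>2 = w\<^sup>2\<close> with \<open>w\<close> commuting with \<open>s\<close>; then \<open>s\<^sup>2 + w\<^sup>2 = 1\<close> forces \<open>nrm w \<le> 1\<close>.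
  Shrinking \<open>s\<close> slightly to \<open>v\<close> makes the square root available.
\<close>

lemma nrm_one_minus_square_le:
  assumes s: "self_adjoint s" and n: "nrm A s \<le> 1"
  shows "nrm A (\<one> \<ominus> s \<otimes> s) \<le> 1"
proof (rule field_le_epsilon)
  fix e :: real assume e: "0 < e"
  define d where "d = min (e / 3) (1 / 2)"
  have d: "0 < d" "3 * d \<le> e" "d < 1" using e by (auto simp: d_def)
  have sc: "s \<in> carrier A" using s by auto
  define v where "v = complex_of_real (sqrt (1 - d)) \<odot> s"
  have v: "self_adjoint v" "v \<in> carrier A"
    using self_adjoint_smult[OF s] by (auto simp: v_def)
  have vv: "v \<otimes> v = complex_of_real (1 - d) \<odot> (s \<otimes> s)"
    using sc d by (simp add: v_def expand_simps flip: of_real_mult)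
  have ss: "nrm A (s \<otimes> s) \<le> 1"
    using n nrm_nonneg[OF sc] by (simp add: nrm_square[OF s] power_le_one)
  have "nrm A (v \<otimes> v) \<le> 1 - d"
    unfolding vv using d ss sc by (simp add: nrm_smult_real mult_left_le del: of_real_diff)
  moreover have "self_adjoint (v \<otimes> v)"
    using v by (simp add: self_adjoint_mult)
  ultimately obtain w where w: "self_adjoint w" "nrm A (\<one> \<ominus> v \<otimes> v \<ominus> w \<otimes> w) \<le> d"
    and comm: "\<forall>z\<in>carrier A. z \<otimes> (v \<otimes> v) = (v \<otimes> v) \<otimes> z \<longrightarrow> z \<otimes> w = w \<otimes> z"
    using approx_sqrt_one_minus[of "v \<otimes> v" "1 - d" d] d(1) by (metis diff_less_eq less_add_same_cancel1)
  have wc: "w \<in> carrier A" using w by auto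
  have "w \<otimes> v = v \<otimes> w"
    using comm v by (simp add: m_assoc)
  then have "nrm A (w \<otimes> w) \<le> nrm A (w \<otimes> w \<oplus> v \<otimes> v)"
    using nrm_square_le_sum_squares[OF w(1) v(1)] by (simp add: nrm_square[OF w(1)])
  moreover have "nrm A (w \<otimes> w \<oplus> v \<otimes> v) \<le> nrm A \<one> + nrm A ((w \<otimes> w \<oplus> v \<otimes> v) \<ominus> \<one>)"
    using wc v by (intro nrm_le_add_dist) auto
  moreover have "nrm A ((w \<otimes> w \<oplus> v \<otimes> v) \<ominus> \<one>) = nrm A (\<one> \<ominus> (w \<otimes> w \<oplus> v \<otimes> v))"
    using wc v by (intro nrm_minus_commute) auto
  moreover have "\<one> \<ominus> (w \<otimes> w \<oplus> v \<otimes> v) = \<one> \<ominus> v \<otimes> v \<ominus> w \<otimes> w"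
    using wc v by (simp add: expand_simps a_ac)
  ultimately have ww: "nrm A (w \<otimes> w) \<le> 1 + d"
    using nrm_one_le w by simp
  have eq: "\<one> \<ominus> s \<otimes> s = w \<otimes> w \<oplus> ((\<one> \<ominus> v \<otimes> v \<ominus> w \<otimes> w) \<ominus> complex_of_real d \<odot> (s \<otimes> s))"
    unfolding vv using wc sc by (simp add: expand_simps a_ac smult_collect)
  have "nrm A (\<one> \<ominus> s \<otimes> s) \<le> nrm A (w \<otimes> w) +
      (nrm A (\<one> \<ominus> v \<otimes> v \<ominus> w \<otimes> w) + nrm A (complex_of_real d \<odot> (s \<otimes> s)))"
    unfolding eq
    using wc v sc by (intro order_trans[OF nrm_triangle] add_left_mono nrm_minus_triangle) auto
  moreover have "nrm A (complex_of_real d \<odot> (s \<otimes> s)) \<le> d"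
    using ss sc d by (simp add: nrm_smult mult_left_le)
  ultimately show "nrm A (\<one> \<ominus> s \<otimes> s) \<le> 1 + e"
    using ww w d by linarith
qed

lemma nrm_scalar_minus_square_le:
  assumes s: "self_adjoint s" and n: "nrm A s \<le> r"
  shows "nrm A (complex_of_real (r\<^sup>2) \<odot> \<one> \<ominus> s \<otimes> s) \<le> r\<^sup>2"
proof (cases "r = 0")
  case True
  then have "s = \<zero>"
    using s n nrm_nonneg[of s] by (simp add: nrm_eq_0_iff self_adjoint_closed)
  then show ?thesis using True by (simp add: minus_eq)
next
  case False
  have sc: "s \<in> carrier A" using s by auto
  then have r: "0 < r" using False n nrm_nonneg[of s] by simp
  define v where "v = complex_of_real (1 / r) \<odot> s"
  have v: "self_adjoint v" "v \<in> carrier A" using self_adjoint_smult[OF s, of "1 / r"] by (auto simp: v_def)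
  have "nrm A v \<le> 1"
    using r n sc by (simp add: v_def nrm_smult norm_divide)
  then have *: "nrm A (\<one> \<ominus> v \<otimes> v) \<le> 1"
    by (rule nrm_one_minus_square_le[OF v(1)])
  have eq: "complex_of_real (r\<^sup>2) \<odot> \<one> \<ominus> s \<otimes> s = complex_of_real (r\<^sup>2) \<odot> (\<one> \<ominus> v \<otimes> v)"
    using sc r by (simp add: v_def expand_simps power2_eq_square)
  have "nrm A (complex_of_real (r\<^sup>2) \<odot> \<one> \<ominus> s \<otimes> s) = r\<^sup>2 * nrm A (\<one> \<ominus> v \<otimes> v)"
    unfolding eq using v by (simp add: nrm_smult norm_power)
  also have "\<dots> \<le> r\<^sup>2"
    using * by (simp add: mult_left_le)
  finally show ?thesis .
qed

text \<open>
  For self-adjoint \<open>h\<close> the estimate \<open>nrm (M - h) \<le> M\<close> expresses positivity of \<open>h\<close>, and the lemma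
  says that \<open>M\<close> may be lowered to any bound of the norm of \<open>h\<close>. The advantage of this form of
  positivity is that it passes to sums by the triangle inequality. Proof: \<open>h / M = 1 - k\<close> with
  \<open>nrm k \<le> 1\<close>, so \<open>h / M\<close> is approximately a square, and the bound for squares applies.
\<close>

lemma nrm_scalar_minus_le_of_bound:
  assumes h: "self_adjoint h" and M: "0 < M" "nrm A (complex_of_real M \<odot> \<one> \<ominus> h) \<le> M"
    and r: "nrm A h \<le> r"
  shows "nrm A (complex_of_real r \<odot> \<one> \<ominus> h) \<le> r"
proof (rule field_le_epsilon)
  fix e :: real assume e: "0 < e"
  define d where "d = min (e / (6 * M)) (1 / 2)"
  have d: "0 < d" "M * (6 * d) \<le> e" "d < 1" using e M
    by (auto simp: d_def min_def field_simps)
  have hc: "h \<in> carrier A" using h by auto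
  have r0: "0 \<le> r" using r nrm_nonneg[OF hc] by simp
  define k where "k = \<one> \<ominus> complex_of_real (1 / M) \<odot> h"
  have k: "self_adjoint k" "k \<in> carrier A"
    using self_adjoint_minus[OF self_adjoint_one self_adjoint_smult[OF h, of "1 / M"]]
    by (auto simp: k_def)
  have "complex_of_real M \<odot> k = complex_of_real M \<odot> \<one> \<ominus> h"
    using M hc by (simp add: k_def expand_simps)
  then have "M * nrm A k \<le> M"
    using M k nrm_smult[of k "complex_of_real M"] by simp
  then have k1: "nrm A k \<le> 1" using M by simp
  define q where "q = complex_of_real (1 - d) \<odot> k"
  have q: "self_adjoint q" "q \<in> carrier A" using self_adjoint_smult[OF k(1), of "1 - d"] by (auto simp: q_def)
  have "nrm A q = (1 - d) * nrm A k"
    unfolding q_def using k d by (simp add: nrm_smult_real del: of_real_diff)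
  then have "nrm A q \<le> 1 - d"
    using k1 d by (simp add: mult_left_le)
  then obtain w where w: "self_adjoint w" "nrm A (\<one> \<ominus> q \<ominus> w \<otimes> w) \<le> d"
    using approx_sqrt_one_minus[of q "1 - d" d] q(1) d(1) by (metis diff_less_eq less_add_same_cancel1)
  have wc: "w \<in> carrier A" using w by auto
  define g where "g = complex_of_real (1 / M) \<odot> h"
  have g: "g \<in> carrier A" using hc by (auto simp: g_def)
  have gr: "nrm A g \<le> r / M"
    using r M hc by (simp add: g_def nrm_smult norm_divide divide_right_mono)
  have kg: "k = \<one> \<ominus> g" by (simp add: k_def g_def)
  have dk: "nrm A (complex_of_real d \<odot> k) \<le> d"
    using k k1 d by (simp add: nrm_smult mult_left_le)
  define D where "D = (complex_of_real d \<odot> k) \<ominus> (\<one> \<ominus> q \<ominus> w \<otimes> w)"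
  have E: "w \<otimes> w = g \<oplus> D"
    unfolding D_def q_def kg using g wc by (simp add: expand_simps a_ac smult_collect)
  have Ec: "D \<in> carrier A" using k q wc by (auto simp: D_def)
  have nE: "nrm A D \<le> 2 * d"
    unfolding D_def using nrm_minus_triangle[of "complex_of_real d \<odot> k" "\<one> \<ominus> q \<ominus> w \<otimes> w"] k q wc dk w by simp
  define rho where "rho = r / M + 2 * d"
  have rho: "0 \<le> rho" using r0 M d by (simp add: rho_def)
  have "(nrm A w)\<^sup>2 \<le> rho"
    unfolding nrm_square[OF w(1), symmetric] rho_def
    unfolding E using nrm_triangle[OF g Ec] gr nE by linarith
  then have "nrm A w \<le> sqrt rho"
    by (rule real_le_rsqrt)
  from nrm_scalar_minus_square_le[OF w(1) this]
  have ww: "nrm A (complex_of_real rho \<odot> \<one> \<ominus> w \<otimes> w) \<le> rho"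
    using rho by simp
  have eq: "complex_of_real r \<odot> \<one> \<ominus> h =
      complex_of_real M \<odot> ((complex_of_real rho \<odot> \<one> \<ominus> w \<otimes> w) \<oplus> (D \<ominus> complex_of_real (2 * d) \<odot> \<one>))"
  proof -
    have *: "(complex_of_real rho \<odot> \<one> \<ominus> (g \<oplus> z)) \<oplus> (z \<ominus> complex_of_real (2 * d) \<odot> \<one>)
       = complex_of_real (rho - 2 * d) \<odot> \<one> \<ominus> g" if "z \<in> carrier A" for z
      using that g by (simp add: expand_simps a_ac smult_collect)
    show ?thesis
      unfolding E *[OF Ec] using M hc by (simp add: rho_def g_def expand_simps)
  qed
  have "nrm A (complex_of_real r \<odot> \<one> \<ominus> h) = M * nrm A ((complex_of_real rho \<odot> \<one> \<ominus> w \<otimes> w) \<oplus> (D \<ominus> complex_of_real (2 * d) \<odot> \<one>))"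
    unfolding eq using M wc Ec by (subst nrm_smult) auto
  also have "\<dots> \<le> M * (rho + (2 * d + 2 * d))"
  proof (intro mult_left_mono)
    have "nrm A (complex_of_real (2 * d) \<odot> \<one>) \<le> 2 * d"
      using nrm_smult_one_le[of "complex_of_real (2 * d)"] d by simp
    then have "nrm A (D \<ominus> complex_of_real (2 * d) \<odot> \<one>) \<le> 2 * d + 2 * d"
      using nrm_minus_triangle[OF Ec, of "complex_of_real (2 * d) \<odot> \<one>"] nE by simp
    then show "nrm A ((complex_of_real rho \<odot> \<one> \<ominus> w \<otimes> w) \<oplus> (D \<ominus> complex_of_real (2 * d) \<odot> \<one>))
        \<le> rho + (2 * d + 2 * d)"
      using nrm_triangle[of "complex_of_real rho \<odot> \<one> \<ominus> w \<otimes> w" "D \<ominus> complex_of_real (2 * d) \<odot> \<one>"]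
        ww wc Ec by simp
  qed (use M in simp)
  also have "\<dots> \<le> r + e"
    using M d by (simp add: rho_def algebra_simps)
  finally show "nrm A (complex_of_real r \<odot> \<one> \<ominus> h) \<le> r + e" .
qed

end

section \<open>Elements of the form a*a\<close>

context pre_cstar_algebra begin

text \<open>
  An element \<open>c* c\<close> cannot be close to \<open>- g\<^sup>2\<close> if \<open>g\<close> has norm one. Suppose \<open>c* c = F - g\<^sup>2\<close> with \<open>F\<close> small. The sum
  \<open>c* c + c c*\<close> is half the sum of the squares of \<open>s = c + c*\<close> and \<open>t = i (c - c*)\<close>, so
  \<open>c c* = P - F\<close> where \<open>P = (s\<^sup>2 + t\<^sup>2) / 2 + g\<^sup>2\<close> is a sum of squares. Thus \<open>1 - c c*\<close> has norm
  about at most \<open>1\<close>. On the other hand \<open>(1 - c c*) c = c (1 - c* c)\<close> is close to \<open>z = c (1 + g\<^sup>2)\<close>, and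
  \<open>z* z\<close> is close to \<open>- (g + g\<^sup>3)\<^sup>2\<close>, which has norm at least \<open>4\<close>: positivity of \<open>c c*\<close> and
  negativity of \<open>c* c\<close> contradict each other.
\<close>

lemma star_square_far_from_negative_square:
  assumes g: "self_adjoint g" "nrm A g = 1" and c: "c \<in> carrier A"
  shows "1 / 20 \<le> nrm A (star A c \<otimes> c \<oplus> g \<otimes> g)"
proof (rule ccontr)
  define F where "F = star A c \<otimes> c \<oplus> g \<otimes> g"
  define e where "e = nrm A F"
  assume "\<not> 1 / 20 \<le> nrm A (star A c \<otimes> c \<oplus> g \<otimes> g)"
  \<comment> \<open>The contradiction below needs \<open>4 e + (1 + 6 e)\<^sup>2 (1 + e) < 4\<close>.\<close>
  then have e: "e < 1 / 20" by (simp add: e_def F_def)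
  have gc: "g \<in> carrier A" using g by auto
  have sc: "star A c \<in> carrier A" using c by (rule star_closed)
  have Fc: "F \<in> carrier A" using c sc gc by (auto simp: F_def)
  have e0: "0 \<le> e" using Fc by (simp add: e_def nrm_nonneg)
  have gg: "nrm A (g \<otimes> g) = 1" using g by (simp add: nrm_square)
  have cc: "star A c \<otimes> c = F \<ominus> g \<otimes> g"
    using c sc gc by (simp add: F_def expand_simps a_ac smult_collect)
  define N where "N = nrm A c"
  have N: "0 \<le> N" "N\<^sup>2 \<le> 1 + e"
  proof -
    have "N\<^sup>2 = nrm A (F \<ominus> g \<otimes> g)"
      using nrm_star_mult[OF c] by (simp add: N_def cc)
    also have "\<dots> \<le> e + 1"
      using nrm_minus_triangle[of F "g \<otimes> g"] Fc gc gg by (simp add: e_def)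
    finally show "N\<^sup>2 \<le> 1 + e" by simp
  qed (use c in \<open>simp add: N_def nrm_nonneg\<close>)
  define s where "s = c \<oplus> star A c"
  define t where "t = \<i> \<odot> (c \<ominus> star A c)"
  have s: "self_adjoint s" "s \<in> carrier A" and t: "self_adjoint t" "t \<in> carrier A"
    using c sc by (auto simp: s_def t_def self_adjoint_def star_add star_smult star_minus star_star a_ac)
      (simp add: expand_simps a_ac)
  have ns: "nrm A s \<le> 2 * N" and nt: "nrm A t \<le> 2 * N"
    using nrm_triangle[OF c sc] nrm_minus_triangle[OF c sc] c sc
    by (simp_all add: s_def t_def N_def nrm_star nrm_smult)
  define P where "P = complex_of_real (1/2) \<odot> (s \<otimes> s) \<oplus> complex_of_real (1/2) \<odot> (t \<otimes> t) \<oplus> g \<otimes> g"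
  have P: "self_adjoint P" unfolding P_def
    by (intro self_adjoint_add self_adjoint_smult self_adjoint_mult s t g refl)
  have Pc: "P \<in> carrier A" using P by auto
  have cs: "c \<otimes> star A c = P \<ominus> F"
    using c sc gc
    by (simp add: P_def F_def s_def t_def expand_simps a_ac smult_collect)
  have nP: "nrm A P \<le> 1 + 2 * e"
  proof -
    have "nrm A (c \<otimes> star A c) = N\<^sup>2"
      using nrm_star_mult[OF sc] c by (simp add: N_def star_star nrm_star)
    moreover have "P \<ominus> (P \<ominus> F) = F"
      using Pc Fc by (simp add: expand_simps a_ac smult_collect)
    ultimately show ?thesis
      using nrm_le_add_dist[of P "P \<ominus> F"] Pc Fc N by (simp add: cs e_def)
  qed
  \<comment> \<open>Each of \<open>s\<^sup>2 / 2\<close> and \<open>t\<^sup>2 / 2\<close> contributes \<open>(2 N)\<^sup>2 / 2\<close>, and \<open>g\<^sup>2\<close> contributes \<open>1\<close>.\<close>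
  define M where "M = 1 + (2 * N)\<^sup>2"
  have M: "0 < M" by (simp add: M_def add_pos_nonneg)
  have "nrm A (complex_of_real M \<odot> \<one> \<ominus> P) \<le> M"
  proof -
    let ?S = "complex_of_real ((2 * N)\<^sup>2) \<odot> \<one> \<ominus> s \<otimes> s"
    let ?T = "complex_of_real ((2 * N)\<^sup>2) \<odot> \<one> \<ominus> t \<otimes> t"
    have eq: "complex_of_real M \<odot> \<one> \<ominus> P =
        (complex_of_real (1/2) \<odot> ?S \<oplus> complex_of_real (1/2) \<odot> ?T) \<oplus> (\<one> \<ominus> g \<otimes> g)"
      using s t gc by (simp add: P_def M_def expand_simps a_ac smult_collect)
    have "nrm A ?S \<le> (2 * N)\<^sup>2" "nrm A ?T \<le> (2 * N)\<^sup>2" "nrm A (\<one> \<ominus> g \<otimes> g) \<le> 1"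
      using nrm_scalar_minus_square_le[OF s(1) ns] nrm_scalar_minus_square_le[OF t(1) nt]
        nrm_one_minus_square_le[OF g(1)] g by auto
    moreover have "nrm A (complex_of_real (1/2) \<odot> ?S) = nrm A ?S / 2"
      "nrm A (complex_of_real (1/2) \<odot> ?T) = nrm A ?T / 2"
      using s t by (simp_all only: nrm_smult_real smult_closed' minus_closed m_closed one_closed)
    moreover have "nrm A (complex_of_real M \<odot> \<one> \<ominus> P) \<le>
        (nrm A (complex_of_real (1/2) \<odot> ?S) + nrm A (complex_of_real (1/2) \<odot> ?T)) + nrm A (\<one> \<ominus> g \<otimes> g)"
      unfolding eq using s t gc
      by (intro order_trans[OF nrm_triangle] add_right_mono nrm_triangle) auto
    ultimately show ?thesis unfolding M_def by linarith
  qed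
  then have "nrm A (complex_of_real (1 + 2 * e) \<odot> \<one> \<ominus> P) \<le> 1 + 2 * e"
    using nrm_scalar_minus_le_of_bound[OF P M _ nP] by blast
  moreover have "\<one> \<ominus> c \<otimes> star A c = (complex_of_real (1 + 2 * e) \<odot> \<one> \<ominus> P)
      \<oplus> (F \<ominus> complex_of_real (2 * e) \<odot> \<one>)"
    unfolding cs using Pc Fc by (simp add: expand_simps a_ac smult_collect)
  moreover have "nrm A (F \<ominus> complex_of_real (2 * e) \<odot> \<one>) \<le> e + 2 * e"
    using nrm_minus_triangle[OF Fc, of "complex_of_real (2 * e) \<odot> \<one>"]
      nrm_smult_one_le[of "complex_of_real (2 * e)"] e0 by (simp add: e_def)
  ultimately have n1: "nrm A (\<one> \<ominus> c \<otimes> star A c) \<le> 1 + 5 * e"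
    using nrm_triangle[of "complex_of_real (1 + 2 * e) \<odot> \<one> \<ominus> P" "F \<ominus> complex_of_real (2 * e) \<odot> \<one>"] Pc Fc
    by simp
  define z where "z = c \<otimes> (\<one> \<oplus> g \<otimes> g)"
  have zc: "z \<in> carrier A" using c gc by (auto simp: z_def)
  have nz: "nrm A z \<le> (1 + 6 * e) * N"
  proof -
    have "c \<otimes> (star A c \<otimes> c) = c \<otimes> (F \<ominus> g \<otimes> g)"
      by (simp only: cc)
    then have "z = (\<one> \<ominus> c \<otimes> star A c) \<otimes> c \<oplus> c \<otimes> F"
      using c sc gc Fc by (simp add: z_def expand_simps a_ac smult_collect)
    then have "nrm A z \<le> nrm A (\<one> \<ominus> c \<otimes> star A c) * N + N * e"
      using c sc Fc unfolding N_def e_def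
      by (auto intro!: order_trans[OF nrm_triangle] add_mono nrm_mult)
    also have "\<dots> \<le> (1 + 5 * e) * N + N * e"
      using n1 N by (intro add_right_mono mult_right_mono) auto
    finally show ?thesis by (simp add: algebra_simps)
  qed
  \<comment> \<open>The identity \<open>(g + g\<^sup>3)\<^sup>2 = (2 g\<^sup>2)\<^sup>2 + (g - g\<^sup>3)\<^sup>2\<close> bounds the norm from below by that of \<open>4 g\<^sup>4\<close>.\<close>
  define k where "k = g \<otimes> g"
  define x where "x = complex_of_real 2 \<odot> k"
  define r where "r = g \<ominus> g \<otimes> k"
  have k: "self_adjoint k" "k \<in> carrier A" "g \<otimes> k = k \<otimes> g"
    using g gc by (auto simp: k_def m_assoc intro!: self_adjoint_mult)
  have x: "self_adjoint x" unfolding x_def by (intro self_adjoint_smult k)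
  have r: "self_adjoint r" unfolding r_def by (intro self_adjoint_minus self_adjoint_mult k g)
  have "x \<otimes> r = r \<otimes> x"
    using gc by (simp add: x_def r_def k_def expand_simps)
  from nrm_square_le_sum_squares[OF x r this]
  have "4 \<le> nrm A (x \<otimes> x \<oplus> r \<otimes> r)"
    using gg k by (simp add: x_def nrm_smult flip: k_def)
  moreover have "star A z \<otimes> z = (\<one> \<oplus> k) \<otimes> F \<otimes> (\<one> \<oplus> k) \<ominus> (x \<otimes> x \<oplus> r \<otimes> r)"
  proof -
    have "star A z \<otimes> z = (\<one> \<oplus> k) \<otimes> (star A c \<otimes> c) \<otimes> (\<one> \<oplus> k)"
      using c sc k self_adjoint_star[OF k(1)]
      by (simp add: z_def star_mult star_add m_assoc flip: k_def)
    also have "\<dots> = (\<one> \<oplus> k) \<otimes> (F \<ominus> g \<otimes> g) \<otimes> (\<one> \<oplus> k)"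
      by (simp only: cc)
    also have "\<dots> = (\<one> \<oplus> k) \<otimes> F \<otimes> (\<one> \<oplus> k) \<ominus> (x \<otimes> x \<oplus> r \<otimes> r)"
      using Fc gc by (simp add: x_def r_def k_def expand_simps a_ac smult_collect)
    finally show ?thesis .
  qed
  moreover have "nrm A ((\<one> \<oplus> k) \<otimes> F \<otimes> (\<one> \<oplus> k)) \<le> 4 * e"
  proof -
    have k2: "nrm A (\<one> \<oplus> k) \<le> 2"
      using nrm_triangle[of \<one> k] nrm_one_le k gg by (simp flip: k_def)
    have "nrm A ((\<one> \<oplus> k) \<otimes> F \<otimes> (\<one> \<oplus> k)) \<le> nrm A (\<one> \<oplus> k) * nrm A F * nrm A (\<one> \<oplus> k)"
      using k Fc by (intro order_trans[OF nrm_mult] mult_right_mono nrm_mult nrm_nonneg) auto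
    also have "\<dots> \<le> 2 * e * 2"
      using k2 e0 k Fc unfolding e_def by (intro mult_mono) (auto simp: nrm_nonneg)
    finally show ?thesis by simp
  qed
  moreover have "nrm A (x \<otimes> x \<oplus> r \<otimes> r) \<le> nrm A Y + nrm A (Y \<ominus> (x \<otimes> x \<oplus> r \<otimes> r))"
    if "Y \<in> carrier A" for Y
    using nrm_le_add_dist[of "x \<otimes> x \<oplus> r \<otimes> r" Y] that x r
    by (simp add: nrm_minus_commute self_adjoint_closed)
  ultimately have "4 \<le> 4 * e + nrm A (star A z \<otimes> z)"
    using k Fc by (smt (verit, ccfv_SIG) a_closed m_closed one_closed)
  also have "nrm A (star A z \<otimes> z) = (nrm A z)\<^sup>2"
    by (rule nrm_star_mult[OF zc])
  also have "(nrm A z)\<^sup>2 \<le> ((1 + 6 * e) * N)\<^sup>2"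
    using nz zc by (intro power_mono nrm_nonneg)
  also have "\<dots> = (1 + 6 * e)\<^sup>2 * N\<^sup>2"
    by (simp add: power_mult_distrib)
  also have "(1 + 6 * e)\<^sup>2 * N\<^sup>2 \<le> (1 + 6 * (1/20))\<^sup>2 * (1 + 1/20)"
    using e e0 N by (intro mult_mono power_mono) auto
  finally have "4 \<le> 4 * e + (1 + 6 * (1/20))\<^sup>2 * (1 + 1/20)"
    by simp
  then show False using e by (simp add: power2_eq_square)
qed

text \<open>
  Scale \<open>a\<close> to norm one. For \<open>c = b a*\<close> and \<open>g = a a*\<close> one has \<open>c* c + g\<^sup>2 = a (a* a + b* b) a*\<close>, so a
  small sum \<open>a* a + b* b\<close> would make \<open>c* c\<close> close to \<open>- g\<^sup>2\<close>.
\<close>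

lemma nrm_star_square_le_sum:
  assumes a: "a \<in> carrier A" and b: "b \<in> carrier A"
  shows "nrm A (star A a \<otimes> a) \<le> 20 * nrm A (star A a \<otimes> a \<oplus> star A b \<otimes> b)"
proof (cases "nrm A a = 0")
  case True
  then show ?thesis
    using a b by (simp add: nrm_star_mult nrm_nonneg star_closed)
next
  case False
  define n where "n = nrm A a"
  have n: "0 < n" using False nrm_nonneg[OF a] by (simp add: n_def)
  define E where "E = star A a \<otimes> a \<oplus> star A b \<otimes> b"
  define i where "i = complex_of_real (1 / n)"
  define u where "u = i \<odot> a"
  define v where "v = i \<odot> b"
  have sa: "star A a \<in> carrier A" "star A b \<in> carrier A" using a b by (auto simp: star_closed)
  have uc: "u \<in> carrier A" and vc: "v \<in> carrier A" and Ec: "E \<in> carrier A"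
    using a b sa by (auto simp: u_def v_def E_def)
  have nu: "nrm A u = 1"
    using a n by (simp add: u_def nrm_smult i_def norm_divide flip: n_def)
  have "1 / 20 \<le> nrm A (star A (v \<otimes> star A u) \<otimes> (v \<otimes> star A u) \<oplus> (u \<otimes> star A u) \<otimes> (u \<otimes> star A u))"
  proof (rule star_square_far_from_negative_square)
    show "self_adjoint (u \<otimes> star A u)"
      using self_adjoint_star_mult[of "star A u"] uc by (simp add: star_closed star_star)
    show "nrm A (u \<otimes> star A u) = 1"
      using nrm_star_mult[of "star A u"] uc nu by (simp add: star_closed star_star nrm_star)
  qed (use uc vc in \<open>auto simp: star_closed\<close>)
  moreover have "star A (v \<otimes> star A u) \<otimes> (v \<otimes> star A u) \<oplus> (u \<otimes> star A u) \<otimes> (u \<otimes> star A u)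
      = u \<otimes> ((i * i) \<odot> E) \<otimes> star A u"
    using a b sa by (simp add: u_def v_def i_def E_def expand_simps star_closed a_ac mult.assoc)
  ultimately have "1 / 20 \<le> nrm A (u \<otimes> ((i * i) \<odot> E) \<otimes> star A u)"
    by simp
  moreover have "nrm A (u \<otimes> ((i * i) \<odot> E) \<otimes> star A u) \<le> nrm A u * nrm A ((i * i) \<odot> E) * nrm A (star A u)"
    using uc Ec by (intro order_trans[OF nrm_mult] mult_right_mono nrm_mult nrm_nonneg) (auto simp: star_closed)
  moreover have "nrm A ((i * i) \<odot> E) = nrm A E / n\<^sup>2"
    using Ec n by (simp add: nrm_smult i_def norm_mult norm_divide power2_eq_square)
  ultimately have "1 / 20 \<le> nrm A E / n\<^sup>2"
    unfolding nrm_star[OF uc] nu by linarith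
  then show ?thesis
    using n a by (simp add: nrm_star_mult E_def field_simps flip: n_def)
qed

end

section \<open>Positivity in the completion\<close>

context pre_cstar_algebra begin

abbreviation cauchy_class :: "(nat \<Rightarrow> 'a) \<Rightarrow> (nat \<Rightarrow> 'a) set" where
  "cauchy_class s \<equiv> cauchy_rel A `` {s}"

lemma cauchy_seqsD: "s \<in> cauchy_seqs A \<Longrightarrow> s n \<in> carrier A"
  by (simp add: cauchy_seqs_def)

lemma const_cauchy_seq: "x \<in> carrier A \<Longrightarrow> (\<lambda>_. x) \<in> cauchy_seqs A"
  by (simp add: cauchy_seqs_def minus_eq r_neg)

lemma nrm_null_sequenceI:
  assumes "\<And>n::nat. x n \<in> carrier A" "\<And>n. nrm A (x n) \<le> y n" "y \<longlonglongrightarrow> 0"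
  shows "(\<lambda>n. nrm A (x n)) \<longlonglongrightarrow> 0"
  using assms by (intro tendsto_sandwich[OF _ _ tendsto_const assms(3)]) (auto simp: nrm_nonneg)

lemma equiv_cauchy_rel: "equiv (cauchy_seqs A) (cauchy_rel A)"
proof (intro equivI)
  show "cauchy_rel A \<subseteq> cauchy_seqs A \<times> cauchy_seqs A"
    by (auto simp: cauchy_rel_def)
  show "refl_on (cauchy_seqs A) (cauchy_rel A)"
    by (auto simp: refl_on_def cauchy_rel_def minus_eq r_neg cauchy_seqsD)
  show "sym (cauchy_rel A)"
    by (auto simp: sym_def cauchy_rel_def nrm_minus_commute cauchy_seqsD)
  show "trans (cauchy_rel A)"
  proof (rule transI)
    fix s t u assume st: "(s, t) \<in> cauchy_rel A" and tu: "(t, u) \<in> cauchy_rel A"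
    then have c: "s n \<in> carrier A" "t n \<in> carrier A" "u n \<in> carrier A" for n
      by (auto simp: cauchy_rel_def cauchy_seqsD)
    have "(\<lambda>n. nrm A (s n \<ominus> t n) + nrm A (t n \<ominus> u n)) \<longlonglongrightarrow> 0"
      using st tu by (intro tendsto_add_zero) (auto simp: cauchy_rel_def)
    then have "(\<lambda>n. nrm A (s n \<ominus> u n)) \<longlonglongrightarrow> 0"
      by (rule nrm_null_sequenceI[rotated 2]) (use c in \<open>auto intro: nrm_dist_triangle\<close>)
    then show "(s, u) \<in> cauchy_rel A"
      using st tu by (auto simp: cauchy_rel_def)
  qed
qed

lemma cauchy_seqs_bounded:
  assumes s: "s \<in> cauchy_seqs A"
  obtains K where "\<And>n. nrm A (s n) \<le> K"
proof -
  obtain N where N: "\<And>m n. m \<ge> N \<Longrightarrow> n \<ge> N \<Longrightarrow> nrm A (s m \<ominus> s n) < 1"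
    using s zero_less_one unfolding cauchy_seqs_def by blast
  define K where "K = Max ((\<lambda>n. nrm A (s n)) ` {..N}) + 1"
  have le: "nrm A (s n) + 1 \<le> K" if "n \<le> N" for n
    using that by (auto simp: K_def)
  have "nrm A (s n) \<le> K" for n
  proof (cases "n \<le> N")
    case True
    then show ?thesis using le[of n] by simp
  next
    case False
    then show ?thesis
      using N[of n N] le[of N] nrm_le_add_dist[of "s n" "s N"] s by (simp add: cauchy_seqsD)
  qed
  then show ?thesis using that by blast
qed

lemma nrm_mult_diff_le:
  assumes "x \<in> carrier A" "y \<in> carrier A" "x' \<in> carrier A" "y' \<in> carrier A"
  shows "nrm A (x \<otimes> y \<ominus> x' \<otimes> y') \<le> nrm A (x \<ominus> x') * nrm A y + nrm A x' * nrm A (y \<ominus> y')"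
proof -
  have eq: "x \<otimes> y \<ominus> x' \<otimes> y' = (x \<ominus> x') \<otimes> y \<oplus> x' \<otimes> (y \<ominus> y')"
    using assms by (simp add: expand_simps a_ac smult_collect)
  show ?thesis
    unfolding eq using assms by (intro order_trans[OF nrm_triangle] add_mono nrm_mult) auto
qed

lemma nrm_add_diff_le:
  assumes "x \<in> carrier A" "y \<in> carrier A" "x' \<in> carrier A" "y' \<in> carrier A"
  shows "nrm A ((x \<oplus> y) \<ominus> (x' \<oplus> y')) \<le> nrm A (x \<ominus> x') + nrm A (y \<ominus> y')"
proof -
  have eq: "(x \<oplus> y) \<ominus> (x' \<oplus> y') = (x \<ominus> x') \<oplus> (y \<ominus> y')"
    using assms by (simp add: expand_simps a_ac)
  show ?thesis
    unfolding eq using assms by (intro nrm_triangle) auto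
qed

lemma cauchy_seqs_star: "s \<in> cauchy_seqs A \<Longrightarrow> (\<lambda>n. star A (s n)) \<in> cauchy_seqs A"
  by (auto simp: cauchy_seqs_def star_closed nrm_star simp flip: star_minus)

lemma cauchy_seqs_add:
  assumes s: "s \<in> cauchy_seqs A" and t: "t \<in> cauchy_seqs A"
  shows "(\<lambda>n. s n \<oplus> t n) \<in> cauchy_seqs A"
  unfolding cauchy_seqs_def
proof (safe)
  fix e :: real assume e: "0 < e"
  obtain N where N: "\<And>m n. m \<ge> N \<Longrightarrow> n \<ge> N \<Longrightarrow> nrm A (s m \<ominus> s n) < e / 2"
    using s e half_gt_zero[of e] unfolding cauchy_seqs_def by blast
  obtain N' where N': "\<And>m n. m \<ge> N' \<Longrightarrow> n \<ge> N' \<Longrightarrow> nrm A (t m \<ominus> t n) < e / 2"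
    using t e half_gt_zero[of e] unfolding cauchy_seqs_def by blast
  have "nrm A ((s m \<oplus> t m) \<ominus> (s n \<oplus> t n)) < e" if "m \<ge> max N N'" "n \<ge> max N N'" for m n
    using that N[of m n] N'[of m n] nrm_add_diff_le[of "s m" "t m" "s n" "t n"] s t
    by (simp add: cauchy_seqsD)
  then show "\<exists>N. \<forall>m\<ge>N. \<forall>n\<ge>N. nrm A ((s m \<oplus> t m) \<ominus> (s n \<oplus> t n)) < e"
    by blast
qed (use s t in \<open>simp add: cauchy_seqsD\<close>)

lemma cauchy_seqs_mult:
  assumes s: "s \<in> cauchy_seqs A" and t: "t \<in> cauchy_seqs A"
  shows "(\<lambda>n. s n \<otimes> t n) \<in> cauchy_seqs A"
  unfolding cauchy_seqs_def
proof (safe)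
  fix e :: real assume e: "0 < e"
  obtain K0 K1 where K01: "\<And>n. nrm A (s n) \<le> K0" "\<And>n. nrm A (t n) \<le> K1"
    using cauchy_seqs_bounded[OF s] cauchy_seqs_bounded[OF t] by metis
  define K where "K = max 1 (max K0 K1)"
  have K: "nrm A (s n) \<le> K" "nrm A (t n) \<le> K" "1 \<le> K" for n
    using K01[of n] by (auto simp: K_def)
  have e': "0 < e / (2 * K)" using e K(3) by simp
  obtain N where N: "\<And>m n. m \<ge> N \<Longrightarrow> n \<ge> N \<Longrightarrow> nrm A (s m \<ominus> s n) < e / (2 * K)"
    using s e' unfolding cauchy_seqs_def by blast
  obtain N' where N': "\<And>m n. m \<ge> N' \<Longrightarrow> n \<ge> N' \<Longrightarrow> nrm A (t m \<ominus> t n) < e / (2 * K)"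
    using t e' unfolding cauchy_seqs_def by blast
  have "nrm A (s m \<otimes> t m \<ominus> s n \<otimes> t n) < e" if "m \<ge> max N N'" "n \<ge> max N N'" for m n
  proof -
    have c: "s m \<in> carrier A" "t m \<in> carrier A" "s n \<in> carrier A" "t n \<in> carrier A"
      using s t by (auto simp: cauchy_seqsD)
    have "nrm A (s m \<ominus> s n) * nrm A (t m) \<le> nrm A (s m \<ominus> s n) * K"
      using K c by (intro mult_left_mono nrm_nonneg) auto
    also have "\<dots> < e / (2 * K) * K"
      using N[of m n] that K(3) by (intro mult_strict_right_mono) auto
    finally have 1: "nrm A (s m \<ominus> s n) * nrm A (t m) < e / 2" using K(3) by simp
    have "nrm A (s n) * nrm A (t m \<ominus> t n) \<le> K * nrm A (t m \<ominus> t n)"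
      using K c by (intro mult_right_mono nrm_nonneg) auto
    also have "\<dots> < K * (e / (2 * K))"
      using N'[of m n] that K(3) by (intro mult_strict_left_mono) auto
    finally have 2: "nrm A (s n) * nrm A (t m \<ominus> t n) < e / 2" using K(3) by simp
    show ?thesis using nrm_mult_diff_le[OF c] 1 2 by linarith
  qed
  then show "\<exists>N. \<forall>m\<ge>N. \<forall>n\<ge>N. nrm A (s m \<otimes> t m \<ominus> s n \<otimes> t n) < e"
    by blast
qed (use s t in \<open>simp add: cauchy_seqsD\<close>)

lemma completion_star:
  assumes "s \<in> cauchy_seqs A"
  shows "star (completion A) (cauchy_class s) = cauchy_class (\<lambda>n. star A (s n))"
proof -
  have "(\<lambda>s. cauchy_class (\<lambda>n. star A (s n))) respects cauchy_rel A"
  proof (rule congruentI)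
    fix s t assume "(s, t) \<in> cauchy_rel A"
    then have "((\<lambda>n. star A (s n)), (\<lambda>n. star A (t n))) \<in> cauchy_rel A"
      by (auto simp: cauchy_rel_def cauchy_seqs_star nrm_star cauchy_seqsD simp flip: star_minus)
    then show "cauchy_class (\<lambda>n. star A (s n)) = cauchy_class (\<lambda>n. star A (t n))"
      by (rule equiv_class_eq[OF equiv_cauchy_rel])
  qed
  from UN_equiv_class[OF equiv_cauchy_rel this assms] show ?thesis
    by (simp add: completion_def)
qed

lemma completion_add:
  assumes "s \<in> cauchy_seqs A" "t \<in> cauchy_seqs A"
  shows "cauchy_class s \<oplus>\<^bsub>completion A\<^esub> cauchy_class t = cauchy_class (\<lambda>n. s n \<oplus> t n)"
proof -
  have "congruent2 (cauchy_rel A) (cauchy_rel A) (\<lambda>s t. cauchy_class (\<lambda>n. s n \<oplus> t n))"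
  proof (rule congruent2I')
    fix s s' t t' assume st: "(s, s') \<in> cauchy_rel A" "(t, t') \<in> cauchy_rel A"
    then have c: "s \<in> cauchy_seqs A" "t \<in> cauchy_seqs A" "s' \<in> cauchy_seqs A" "t' \<in> cauchy_seqs A"
      by (auto simp: cauchy_rel_def)
    have "(\<lambda>n. nrm A (s n \<ominus> s' n) + nrm A (t n \<ominus> t' n)) \<longlonglongrightarrow> 0"
      using st by (intro tendsto_add_zero) (auto simp: cauchy_rel_def)
    then have "(\<lambda>n. nrm A ((s n \<oplus> t n) \<ominus> (s' n \<oplus> t' n))) \<longlonglongrightarrow> 0"
      by (rule nrm_null_sequenceI[rotated 2]) (use c in \<open>auto intro!: nrm_add_diff_le simp: cauchy_seqsD\<close>)
    then have "((\<lambda>n. s n \<oplus> t n), (\<lambda>n. s' n \<oplus> t' n)) \<in> cauchy_rel A"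
      using c by (simp add: cauchy_rel_def cauchy_seqs_add)
    then show "cauchy_class (\<lambda>n. s n \<oplus> t n) = cauchy_class (\<lambda>n. s' n \<oplus> t' n)"
      by (rule equiv_class_eq[OF equiv_cauchy_rel])
  qed
  from UN_equiv_class2[OF equiv_cauchy_rel equiv_cauchy_rel this assms] show ?thesis
    by (simp add: completion_def)
qed

lemma completion_mult:
  assumes "s \<in> cauchy_seqs A" "t \<in> cauchy_seqs A"
  shows "cauchy_class s \<otimes>\<^bsub>completion A\<^esub> cauchy_class t = cauchy_class (\<lambda>n. s n \<otimes> t n)"
proof -
  have "congruent2 (cauchy_rel A) (cauchy_rel A) (\<lambda>s t. cauchy_class (\<lambda>n. s n \<otimes> t n))"
  proof (rule congruent2I')
    fix s s' t t' assume st: "(s, s') \<in> cauchy_rel A" "(t, t') \<in> cauchy_rel A"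
    then have c: "s \<in> cauchy_seqs A" "t \<in> cauchy_seqs A" "s' \<in> cauchy_seqs A" "t' \<in> cauchy_seqs A"
      by (auto simp: cauchy_rel_def)
    obtain K where K: "\<And>n. nrm A (t n) \<le> K" using cauchy_seqs_bounded[OF c(2)] by blast
    obtain L where L: "\<And>n. nrm A (s' n) \<le> L" using cauchy_seqs_bounded[OF c(3)] by blast
    have "(\<lambda>n. nrm A (s n \<ominus> s' n) * K + L * nrm A (t n \<ominus> t' n)) \<longlonglongrightarrow> 0"
      using st by (intro tendsto_add_zero tendsto_mult_left_zero tendsto_mult_right_zero)
        (auto simp: cauchy_rel_def)
    then have "(\<lambda>n. nrm A (s n \<otimes> t n \<ominus> s' n \<otimes> t' n)) \<longlonglongrightarrow> 0"
    proof (rule nrm_null_sequenceI[rotated 2])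
      fix n
      show "nrm A (s n \<otimes> t n \<ominus> s' n \<otimes> t' n) \<le> nrm A (s n \<ominus> s' n) * K + L * nrm A (t n \<ominus> t' n)"
        using c K L
        by (intro order_trans[OF nrm_mult_diff_le] add_mono mult_left_mono mult_right_mono nrm_nonneg)
          (auto simp: cauchy_seqsD)
    qed (use c in \<open>auto simp: cauchy_seqsD\<close>)
    then have "((\<lambda>n. s n \<otimes> t n), (\<lambda>n. s' n \<otimes> t' n)) \<in> cauchy_rel A"
      using c by (simp add: cauchy_rel_def cauchy_seqs_mult)
    then show "cauchy_class (\<lambda>n. s n \<otimes> t n) = cauchy_class (\<lambda>n. s' n \<otimes> t' n)"
      by (rule equiv_class_eq[OF equiv_cauchy_rel])
  qed
  from UN_equiv_class2[OF equiv_cauchy_rel equiv_cauchy_rel this assms] show ?thesis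
    by (simp add: completion_def)
qed

lemma carrier_completion: "carrier (completion A) = cauchy_seqs A // cauchy_rel A"
  by (simp add: completion_def)

lemma zero_completion: "\<zero>\<^bsub>completion A\<^esub> = cauchy_class (\<lambda>_. \<zero>)"
  by (simp add: completion_def completion_emb_def)

end

lemma foldD_singleton:
  assumes "e \<in> D" "f a e \<in> D"
  shows "foldD D f e {a} = f a e"
  unfolding foldD_def
proof (rule the_equality)
  show "({a}, f a e) \<in> foldSetD D f e"
    using assms by (auto intro!: foldSetD.intros)
  fix x assume "({a}, x) \<in> foldSetD D f e"
  then show "x = f a e"
    by (cases rule: foldSetD.cases) (auto elim: foldSetD.cases)
qed

text \<open>
  A sum over one index in an arbitrary structure, so that matrix products over the completion can be
  computed before any algebraic law of the completion is known.
\<close>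

lemma finsum_singleton_zero:
  assumes "\<zero>\<^bsub>G\<^esub> \<in> carrier G" "f a \<oplus>\<^bsub>G\<^esub> \<zero>\<^bsub>G\<^esub> \<in> carrier G"
  shows "finsum G f {a} = f a \<oplus>\<^bsub>G\<^esub> \<zero>\<^bsub>G\<^esub>"
  using foldD_singleton[of "\<zero>\<^bsub>G\<^esub>" "carrier G" "\<lambda>x. (\<oplus>\<^bsub>G\<^esub>) (f x)" a] assms
  by (simp add: finsum_def finprod_def comp_def)

context pre_cstar_algebra begin

lemma star_mult_matrix_1:
  assumes Y: "Y \<in> carrier (matrix_alg 1 (completion A))" and s: "s \<in> cauchy_seqs A"
    and eq: "Y (0, 0) = cauchy_class s"
  shows "(star (matrix_alg 1 (completion A)) Y \<otimes>\<^bsub>matrix_alg 1 (completion A)\<^esub> Y) =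
    (\<lambda>_\<in>{..<1} \<times> {..<1}. cauchy_class (\<lambda>n. star A (s n) \<otimes> s n))"
proof -
  have 1: "star (completion A) (cauchy_class s) \<otimes>\<^bsub>completion A\<^esub> cauchy_class s =
      cauchy_class (\<lambda>n. star A (s n) \<otimes> s n)"
    using s by (simp add: completion_star completion_mult cauchy_seqs_star)
  have c: "(\<lambda>n. star A (s n) \<otimes> s n) \<in> cauchy_seqs A"
    using s by (intro cauchy_seqs_mult cauchy_seqs_star)
  have 2: "cauchy_class (\<lambda>n. star A (s n) \<otimes> s n) \<oplus>\<^bsub>completion A\<^esub> \<zero>\<^bsub>completion A\<^esub> =
      cauchy_class (\<lambda>n. star A (s n) \<otimes> s n)"
    using c s by (simp add: zero_completion completion_add const_cauchy_seq cauchy_seqsD star_closed)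
  have 3: "finsum (completion A) f {0::nat} = cauchy_class (\<lambda>n. star A (s n) \<otimes> s n)"
    if f: "f 0 = cauchy_class (\<lambda>n. star A (s n) \<otimes> s n)" for f
  proof (subst finsum_singleton_zero)
    show "\<zero>\<^bsub>completion A\<^esub> \<in> carrier (completion A)"
      by (simp add: zero_completion carrier_completion quotientI const_cauchy_seq)
  qed (use c in \<open>simp_all add: f 2 carrier_completion quotientI\<close>)
  have I: "{..<1} = {0::nat}" by auto
  show ?thesis
    unfolding matrix_alg_def Let_def I by (auto intro!: restrict_ext 3 simp: eq 1)
qed

text \<open>
  Elements of the algebra are represented by constant sequences, so \<open>z* z\<close> is positive with witness
  the class of \<open>z\<close>.
\<close>

lemma star_square_positive:
  assumes z: "z \<in> carrier A"
  shows "(\<lambda>_\<in>{..<1} \<times> {..<1}. star A z \<otimes> z) \<in> positive_matrices 1 A"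
proof -
  define Y where "Y = (\<lambda>_\<in>{..<1::nat} \<times> {..<1::nat}. completion_emb A z)"
  have Y: "Y \<in> carrier (matrix_alg 1 (completion A))"
    using const_cauchy_seq[OF z]
    by (auto simp: Y_def matrix_alg_def Let_def carrier_completion completion_emb_def intro!: quotientI)
  have "star (matrix_alg 1 (completion A)) Y \<otimes>\<^bsub>matrix_alg 1 (completion A)\<^esub> Y =
    (\<lambda>_\<in>{..<1} \<times> {..<1}. cauchy_class (\<lambda>n. star A z \<otimes> z))"
    by (rule star_mult_matrix_1[OF Y const_cauchy_seq[OF z]]) (simp add: Y_def completion_emb_def)
  moreover have "matrix_map 1 (completion_emb A) (\<lambda>_\<in>{..<1} \<times> {..<1}. star A z \<otimes> z) =
    (\<lambda>_\<in>{..<1} \<times> {..<1}. cauchy_class (\<lambda>n. star A z \<otimes> z))"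
    by (auto simp: matrix_map_def completion_emb_def intro!: restrict_ext)
  moreover have "(\<lambda>_\<in>{..<1} \<times> {..<1}. star A z \<otimes> z) \<in> carrier (matrix_alg 1 A)"
    using z by (auto simp: matrix_alg_def Let_def star_closed)
  ultimately show ?thesis
    using Y unfolding positive_matrices_def by (intro CollectI conjI bexI[of _ Y]) simp_all
qed

text \<open>
  A witness \<open>Y\<close> of positivity is the class of a Cauchy sequence \<open>s\<close>, and the entry of \<open>X\<close> is the
  limit of \<open>s\<^sub>n* s\<^sub>n\<close>. In this form positivity is available without passing to the completion.
\<close>

lemma positive_approx_star_square:
  assumes X: "X \<in> positive_matrices 1 A" and e: "0 < e"
  shows "\<exists>z\<in>carrier A. nrm A (X (0, 0) \<ominus> star A z \<otimes> z) < e"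
proof -
  from X obtain Y where Xc: "X \<in> carrier (matrix_alg 1 A)"
    and Y: "Y \<in> carrier (matrix_alg 1 (completion A))"
    and eq: "matrix_map 1 (completion_emb A) X =
      star (matrix_alg 1 (completion A)) Y \<otimes>\<^bsub>matrix_alg 1 (completion A)\<^esub> Y"
    unfolding positive_matrices_def by blast
  have x: "X (0, 0) \<in> carrier A" using Xc by (auto simp: matrix_alg_def Let_def)
  have "Y (0, 0) \<in> cauchy_seqs A // cauchy_rel A"
    using Y by (auto simp: matrix_alg_def Let_def carrier_completion)
  then obtain s where s: "s \<in> cauchy_seqs A" "Y (0, 0) = cauchy_class s"
    by (auto elim: quotientE)
  have "cauchy_class (\<lambda>_. X (0, 0)) = cauchy_class (\<lambda>n. star A (s n) \<otimes> s n)"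
    using fun_cong[OF eq[unfolded star_mult_matrix_1[OF Y s]], of "(0, 0)"]
    by (simp add: matrix_map_def completion_emb_def)
  then have "((\<lambda>_. X (0, 0)), (\<lambda>n. star A (s n) \<otimes> s n)) \<in> cauchy_rel A"
    using eq_equiv_class[OF _ equiv_cauchy_rel] s cauchy_seqs_mult[OF cauchy_seqs_star s(1)] by blast
  then have "(\<lambda>n. nrm A (X (0, 0) \<ominus> star A (s n) \<otimes> s n)) \<longlonglongrightarrow> 0"
    by (simp add: cauchy_rel_def)
  then have "eventually (\<lambda>n. nrm A (X (0, 0) \<ominus> star A (s n) \<otimes> s n) < e) sequentially"
    using e by (rule order_tendstoD)
  then show ?thesis
    using s by (auto simp: eventually_sequentially cauchy_seqsD)
qed

end

section \<open>The degenerate Cauchy-Schwarz inequality\<close>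

context pre_cstar_algebra begin

lemma nrm_le_sum_of_approx_star_squares:
  assumes h: "h \<in> carrier A" "\<And>e. 0 < e \<Longrightarrow> \<exists>z\<in>carrier A. nrm A (h \<ominus> star A z \<otimes> z) < e"
    and k: "k \<in> carrier A" "\<And>e. 0 < e \<Longrightarrow> \<exists>z\<in>carrier A. nrm A (k \<ominus> star A z \<otimes> z) < e"
  shows "nrm A h \<le> 20 * nrm A (h \<oplus> k)"
proof (rule field_le_epsilon)
  fix e :: real assume e: "0 < e"
  \<comment> \<open>The error of the first square enters \<open>20 + 1\<close> times, that of the second \<open>20\<close> times.\<close>
  obtain a where a: "a \<in> carrier A" "nrm A (h \<ominus> star A a \<otimes> a) < e / 41"
    using h(2)[of "e / 41"] e by auto
  obtain b where b: "b \<in> carrier A" "nrm A (k \<ominus> star A b \<otimes> b) < e / 41"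
    using k(2)[of "e / 41"] e by auto
  define a2 where "a2 = star A a \<otimes> a"
  define b2 where "b2 = star A b \<otimes> b"
  have c: "a2 \<in> carrier A" "b2 \<in> carrier A" using a b by (auto simp: a2_def b2_def star_closed)
  have "nrm A a2 \<le> 20 * nrm A (a2 \<oplus> b2)"
    unfolding a2_def b2_def by (rule nrm_star_square_le_sum[OF a(1) b(1)])
  moreover have "nrm A (a2 \<oplus> b2) \<le> nrm A (h \<oplus> k) + nrm A ((a2 \<oplus> b2) \<ominus> (h \<oplus> k))"
    using c h(1) k(1) by (intro nrm_le_add_dist) auto
  moreover have "nrm A ((a2 \<oplus> b2) \<ominus> (h \<oplus> k)) \<le> nrm A (a2 \<ominus> h) + nrm A (b2 \<ominus> k)"
    using c h(1) k(1) by (intro nrm_add_diff_le)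
  moreover have "nrm A h \<le> nrm A a2 + nrm A (h \<ominus> a2)"
    using c h(1) by (intro nrm_le_add_dist)
  ultimately show "nrm A h \<le> 20 * nrm A (h \<oplus> k) + e"
    using a(2) b(2) nrm_minus_commute[OF h(1) c(1)] nrm_minus_commute[OF k(1) c(2)]
    unfolding a2_def[symmetric] b2_def[symmetric] by linarith
qed

end

lemma cp_star_square_approx:
  assumes A: "pre_cstar_algebra A" and B: "pre_cstar_algebra B"
    and cp: "completely_positive B A f" and w: "w \<in> carrier B" and e: "0 < e"
  shows "\<exists>z\<in>carrier A. nrm A (f (star B w \<otimes>\<^bsub>B\<^esub> w) \<ominus>\<^bsub>A\<^esub> star A z \<otimes>\<^bsub>A\<^esub> z) < e"
proof -
  interpret A: pre_cstar_algebra A by (rule A)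
  interpret B: pre_cstar_algebra B by (rule B)
  let ?X = "\<lambda>_\<in>{..<1::nat} \<times> {..<1::nat}. star B w \<otimes>\<^bsub>B\<^esub> w"
  have "matrix_map 1 f ?X \<in> positive_matrices 1 A"
    using cp B.star_square_positive[OF w] unfolding completely_positive_def by blast
  from A.positive_approx_star_square[OF this e] show ?thesis
    by (simp add: matrix_map_def)
qed

text \<open>
  The function \<open>h l = f ((x + l b)* (x + l b))\<close> has positive values, and by the hypothesis it has no
  constant term: \<open>h l = l c + cnj l c' + |l|\<^sup>2 d\<close>. The terms of first order cancel in \<open>h l + h (- l)\<close>,
  so \<open>h l\<close> is of second order in \<open>l\<close>, and so is \<open>l c + cnj l c'\<close>. Taking \<open>l\<close> to be small and real, or
  small and imaginary, gives \<open>c + c' = 0\<close> and \<open>c - c' = 0\<close>.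
\<close>

lemma cp_null_cross_terms:
  assumes A: "pre_cstar_algebra A" and B: "pre_cstar_algebra B"
    and f: "f \<in> unital_linear_maps B A" and cp: "completely_positive B A f"
    and x: "x \<in> carrier B" and b: "b \<in> carrier B"
    and null: "f (star B x \<otimes>\<^bsub>B\<^esub> x) = \<zero>\<^bsub>A\<^esub>"
  shows "f (star B x \<otimes>\<^bsub>B\<^esub> b) = \<zero>\<^bsub>A\<^esub> \<and> f (star B b \<otimes>\<^bsub>B\<^esub> x) = \<zero>\<^bsub>A\<^esub>"
proof -
  interpret A: pre_cstar_algebra A by (rule A)
  interpret B: pre_cstar_algebra B by (rule B)
  have f_closed: "f u \<in> carrier A" if "u \<in> carrier B" for u
    using f that by (auto simp: unital_linear_maps_def)
  have f_add: "f (u \<oplus>\<^bsub>B\<^esub> v) = f u \<oplus>\<^bsub>A\<^esub> f v" if "u \<in> carrier B" "v \<in> carrier B" for u v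
    using f that by (auto simp: unital_linear_maps_def)
  have f_smult: "f (k \<odot>\<^bsub>B\<^esub> u) = k \<odot>\<^bsub>A\<^esub> f u" if "u \<in> carrier B" for u k
    using f that by (auto simp: unital_linear_maps_def)
  define c where "c = f (star B x \<otimes>\<^bsub>B\<^esub> b)"
  define c' where "c' = f (star B b \<otimes>\<^bsub>B\<^esub> x)"
  define d where "d = f (star B b \<otimes>\<^bsub>B\<^esub> b)"
  have closed: "c \<in> carrier A" "c' \<in> carrier A" "d \<in> carrier A"
    using x b by (auto simp: c_def c'_def d_def B.star_closed intro!: f_closed)
  define h where "h l = f (star B (x \<oplus>\<^bsub>B\<^esub> l \<odot>\<^bsub>B\<^esub> b) \<otimes>\<^bsub>B\<^esub> (x \<oplus>\<^bsub>B\<^esub> l \<odot>\<^bsub>B\<^esub> b))" for l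
  have h: "h l = l \<odot>\<^bsub>A\<^esub> c \<oplus>\<^bsub>A\<^esub> (cnj l \<odot>\<^bsub>A\<^esub> c' \<oplus>\<^bsub>A\<^esub> (l * cnj l) \<odot>\<^bsub>A\<^esub> d)" for l
  proof -
    have "star B (x \<oplus>\<^bsub>B\<^esub> l \<odot>\<^bsub>B\<^esub> b) \<otimes>\<^bsub>B\<^esub> (x \<oplus>\<^bsub>B\<^esub> l \<odot>\<^bsub>B\<^esub> b) =
        star B x \<otimes>\<^bsub>B\<^esub> x \<oplus>\<^bsub>B\<^esub> (l \<odot>\<^bsub>B\<^esub> (star B x \<otimes>\<^bsub>B\<^esub> b) \<oplus>\<^bsub>B\<^esub>
          (cnj l \<odot>\<^bsub>B\<^esub> (star B b \<otimes>\<^bsub>B\<^esub> x) \<oplus>\<^bsub>B\<^esub> (l * cnj l) \<odot>\<^bsub>B\<^esub> (star B b \<otimes>\<^bsub>B\<^esub> b)))"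
      using x b by (simp add: B.expand_simps B.a_ac B.star_closed mult.commute)
    then show ?thesis
      unfolding h_def using x b closed
      by (simp add: f_add f_smult B.star_closed null flip: c_def c'_def d_def)
  qed
  have h_closed: "h l \<in> carrier A" for l
    using closed by (auto simp: h)
  have bound: "nrm A (l \<odot>\<^bsub>A\<^esub> c \<oplus>\<^bsub>A\<^esub> cnj l \<odot>\<^bsub>A\<^esub> c') \<le> 41 * (cmod l)\<^sup>2 * nrm A d" for l
  proof -
    have sq: "cmod (l * cnj l) = (cmod l)\<^sup>2"
      by (simp add: norm_mult power2_eq_square)
    have approx: "\<exists>z\<in>carrier A. nrm A (h m \<ominus>\<^bsub>A\<^esub> star A z \<otimes>\<^bsub>A\<^esub> z) < e" if "0 < e" for e m
      unfolding h_def using x b that by (intro cp_star_square_approx[OF A B cp]) auto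
    have "nrm A (h l) \<le> 20 * nrm A (h l \<oplus>\<^bsub>A\<^esub> h (- l))"
      by (intro A.nrm_le_sum_of_approx_star_squares h_closed approx)
    also have "h l \<oplus>\<^bsub>A\<^esub> h (- l) = (2 * (l * cnj l)) \<odot>\<^bsub>A\<^esub> d"
      using closed by (simp add: h A.a_ac A.smult_collect A.smult_smult)
    also have "nrm A \<dots> = 2 * (cmod l)\<^sup>2 * nrm A d"
      using closed sq by (simp add: A.nrm_smult norm_mult power2_eq_square)
    finally have "nrm A (h l) \<le> 40 * (cmod l)\<^sup>2 * nrm A d"
      by simp
    moreover have "l \<odot>\<^bsub>A\<^esub> c \<oplus>\<^bsub>A\<^esub> cnj l \<odot>\<^bsub>A\<^esub> c' = h l \<ominus>\<^bsub>A\<^esub> (l * cnj l) \<odot>\<^bsub>A\<^esub> d"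
      using closed by (simp add: h A.expand_simps A.a_ac A.smult_collect)
    moreover have "nrm A ((l * cnj l) \<odot>\<^bsub>A\<^esub> d) = (cmod l)\<^sup>2 * nrm A d"
      using closed sq by (simp add: A.nrm_smult)
    ultimately show ?thesis
      using A.nrm_minus_triangle[OF h_closed[of l], of "(l * cnj l) \<odot>\<^bsub>A\<^esub> d"] closed by simp
  qed
  \<comment> \<open>Divide the estimate at \<open>l = r u\<close> by \<open>r u\<close> and let \<open>r\<close> tend to zero.\<close>
  have zero: "c \<oplus>\<^bsub>A\<^esub> k \<odot>\<^bsub>A\<^esub> c' = \<zero>\<^bsub>A\<^esub>" if u: "cmod u = 1" and k: "k = cnj u * cnj u" for u k
  proof -
    let ?n = "nrm A (c \<oplus>\<^bsub>A\<^esub> k \<odot>\<^bsub>A\<^esub> c')"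
    have uu: "u * cnj u = 1" using u by (simp add: complex_norm_square[symmetric])
    have le: "?n \<le> 41 * r * nrm A d" if r: "0 < r" for r
    proof -
      have "complex_of_real r * u * k = complex_of_real r * (u * cnj u) * cnj u"
        by (simp only: k mult.assoc)
      then have scal: "complex_of_real r * u * k = complex_of_real r * cnj u"
        by (simp only: uu mult_1_right)
      have "(complex_of_real r * u) \<odot>\<^bsub>A\<^esub> (c \<oplus>\<^bsub>A\<^esub> k \<odot>\<^bsub>A\<^esub> c') =
          (complex_of_real r * u) \<odot>\<^bsub>A\<^esub> c \<oplus>\<^bsub>A\<^esub> cnj (complex_of_real r * u) \<odot>\<^bsub>A\<^esub> c'"
        using closed by (simp add: A.smult_add A.smult_smult scal)
      then have "r * ?n \<le> 41 * r\<^sup>2 * nrm A d"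
        using bound[of "complex_of_real r * u"] closed r u
          A.nrm_smult[of "c \<oplus>\<^bsub>A\<^esub> k \<odot>\<^bsub>A\<^esub> c'" "complex_of_real r * u"] by (simp add: norm_mult)
      then show ?thesis using r by (simp add: power2_eq_square)
    qed
    have "?n \<le> 0"
    proof (rule field_le_epsilon)
      fix e :: real assume e: "0 < e"
      have nd: "0 \<le> nrm A d" using closed by (simp add: A.nrm_nonneg)
      have "41 * (e / (41 * (nrm A d + 1))) * nrm A d \<le> e"
        using e nd by (simp add: field_simps)
      then show "?n \<le> 0 + e"
        using le[of "e / (41 * (nrm A d + 1))"] e nd by (simp add: add_nonneg_pos)
    qed
    then show ?thesis
      using A.nrm_nonneg[of "c \<oplus>\<^bsub>A\<^esub> k \<odot>\<^bsub>A\<^esub> c'"] closed by (simp add: A.nrm_eq_0_iff)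
  qed
  have plus: "c \<oplus>\<^bsub>A\<^esub> c' = \<zero>\<^bsub>A\<^esub>" and minus: "c \<oplus>\<^bsub>A\<^esub> (- 1) \<odot>\<^bsub>A\<^esub> c' = \<zero>\<^bsub>A\<^esub>"
    using zero[of 1 1] zero[of \<i> "- 1"] closed by simp_all
  have "2 \<odot>\<^bsub>A\<^esub> c = (c \<oplus>\<^bsub>A\<^esub> c') \<oplus>\<^bsub>A\<^esub> (c \<oplus>\<^bsub>A\<^esub> (- 1) \<odot>\<^bsub>A\<^esub> c')"
    using closed by (simp add: A.a_ac A.smult_collect)
  then have "2 \<odot>\<^bsub>A\<^esub> c = \<zero>\<^bsub>A\<^esub>" using plus minus by simp
  then have "nrm A (2 \<odot>\<^bsub>A\<^esub> c) = 0" by simp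
  then have "c = \<zero>\<^bsub>A\<^esub>"
    using closed by (simp add: A.nrm_smult A.nrm_eq_0_iff)
  then show ?thesis
    using plus closed by (simp add: c_def c'_def)
qed

section \<open>Linear maps on algebraic tensor products\<close>

text \<open>
  The tensor products enter only as carriers with addition and scalar multiplication, so closure
  under these two operations replaces the axioms of a *-algebra.
\<close>

definition add_smult_closed :: "('a, 'm) star_alg_scheme \<Rightarrow> bool" where
  "add_smult_closed A \<longleftrightarrow>
    (\<forall>x\<in>carrier A. \<forall>y\<in>carrier A. x \<oplus>\<^bsub>A\<^esub> y \<in> carrier A) \<and>
    (\<forall>c. \<forall>x\<in>carrier A. c \<odot>\<^bsub>A\<^esub> x \<in> carrier A)"

definition linear_between ::
    "('a, 'm) star_alg_scheme \<Rightarrow> ('b, 'n) star_alg_scheme \<Rightarrow> ('a \<Rightarrow> 'b) \<Rightarrow> bool" where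
  "linear_between A B f \<longleftrightarrow>
    (\<forall>x\<in>carrier A. f x \<in> carrier B) \<and>
    (\<forall>x\<in>carrier A. \<forall>y\<in>carrier A. f (x \<oplus>\<^bsub>A\<^esub> y) = f x \<oplus>\<^bsub>B\<^esub> f y) \<and>
    (\<forall>c. \<forall>x\<in>carrier A. f (c \<odot>\<^bsub>A\<^esub> x) = c \<odot>\<^bsub>B\<^esub> f x)"

lemma (in star_algebra) add_smult_closed: "add_smult_closed A"
  by (auto simp: add_smult_closed_def)

lemma linear_between_compose:
  "linear_between A B f \<Longrightarrow> linear_between B C g \<Longrightarrow> linear_between A C (\<lambda>x. g (f x))"
  by (simp add: linear_between_def)

lemma linear_between_restrict:
  "linear_between A B f \<Longrightarrow> add_smult_closed A \<Longrightarrow> linear_between A B (restrict f (carrier A))"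
  by (simp add: linear_between_def add_smult_closed_def)

abbreviation scale :: "complex \<Rightarrow> ('a \<Rightarrow>\<^sub>0 complex) \<Rightarrow> ('a \<Rightarrow>\<^sub>0 complex)" where
  "scale c \<equiv> Poly_Mapping.map ((*) c)"

lemma lookup_scale: "Poly_Mapping.lookup (scale c r) p = c * Poly_Mapping.lookup r p"
  by (simp add: Poly_Mapping.map.rep_eq when_def)

lemma scale_add: "scale c (r + s) = scale c r + scale c s"
  by (intro poly_mapping_eqI) (simp add: lookup_scale lookup_add distrib_left)

lemma scale_diff: "scale c (r - s) = scale c r - scale c s"
  by (intro poly_mapping_eqI) (simp add: lookup_scale lookup_minus right_diff_distrib)

lemma scale_0: "scale c 0 = 0"
  by (intro poly_mapping_eqI) (simp add: lookup_scale)

lemma scale_minus_1: "scale (- 1) r = - r"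
  by (intro poly_mapping_eqI) (simp add: lookup_scale)

lemma scale_single: "scale c (Poly_Mapping.single p d) = Poly_Mapping.single p (c * d)"
  by (intro poly_mapping_eqI) (simp add: lookup_scale lookup_single when_def)

lemma keys_scale: "Poly_Mapping.keys (scale c r) \<subseteq> Poly_Mapping.keys r"
  by (auto simp: in_keys_iff lookup_scale)

lemma scale_sum: "scale c (\<Sum>i\<in>I. r i) = (\<Sum>i\<in>I. scale c (r i))"
  by (induction I rule: infinite_finite_induct) (simp_all add: scale_0 scale_add)

lemma tensor_free_zero: "0 \<in> tensor_free A B"
  by (simp add: tensor_free_def)

lemma tensor_free_add: "r \<in> tensor_free A B \<Longrightarrow> s \<in> tensor_free A B \<Longrightarrow> r + s \<in> tensor_free A B"
  using Poly_Mapping.keys_add[of r s] by (auto simp: tensor_free_def)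

lemma tensor_free_diff: "r \<in> tensor_free A B \<Longrightarrow> s \<in> tensor_free A B \<Longrightarrow> r - s \<in> tensor_free A B"
  using keys_diff[of r s] by (auto simp: tensor_free_def)

lemma tensor_free_scale: "r \<in> tensor_free A B \<Longrightarrow> scale c r \<in> tensor_free A B"
  using keys_scale[of c r] by (auto simp: tensor_free_def)

lemma tensor_free_single:
  "a \<in> carrier A \<Longrightarrow> b \<in> carrier B \<Longrightarrow> Poly_Mapping.single (a, b) c \<in> tensor_free A B"
  by (auto simp: tensor_free_def)

lemma tensor_null_uminus: "r \<in> tensor_null A B \<Longrightarrow> - r \<in> tensor_null A B"
  using tensor_null.scale[of r A B "- 1"] by (simp add: scale_minus_1)

abbreviation tensor_class ::
    "('a, 'm) star_alg_scheme \<Rightarrow> ('b, 'n) star_alg_scheme \<Rightarrow> ('a \<times> 'b \<Rightarrow>\<^sub>0 complex) \<Rightarrow>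
     ('a \<times> 'b \<Rightarrow>\<^sub>0 complex) set" where
  "tensor_class A B r \<equiv> tensor_rel A B `` {r}"

lemma equiv_tensor_rel: "equiv (tensor_free A B) (tensor_rel A B)"
proof (intro equivI)
  show "refl_on (tensor_free A B) (tensor_rel A B)"
    by (auto simp: refl_on_def tensor_rel_def intro: tensor_null.zero)
  show "sym (tensor_rel A B)"
    by (auto simp: sym_def tensor_rel_def dest: tensor_null_uminus)
  show "trans (tensor_rel A B)"
  proof (rule transI)
    fix r s u assume "(r, s) \<in> tensor_rel A B" "(s, u) \<in> tensor_rel A B"
    then show "(r, u) \<in> tensor_rel A B"
      using tensor_null.add[of "r - s" A B "s - u"] by (auto simp: tensor_rel_def)
  qed
qed (auto simp: tensor_rel_def)

lemma tensor_class_eqI: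
  "r \<in> tensor_free A B \<Longrightarrow> s \<in> tensor_free A B \<Longrightarrow> r - s \<in> tensor_null A B \<Longrightarrow>
    tensor_class A B r = tensor_class A B s"
  by (rule equiv_class_eq[OF equiv_tensor_rel]) (simp add: tensor_rel_def)

lemma carrier_alg_tensor: "carrier (alg_tensor A B) = tensor_free A B // tensor_rel A B"
  by (simp add: alg_tensor_def)

lemma tensor_class_closed: "r \<in> tensor_free A B \<Longrightarrow> tensor_class A B r \<in> carrier (alg_tensor A B)"
  by (simp add: carrier_alg_tensor quotientI)

lemma carrier_alg_tensorE:
  assumes "X \<in> carrier (alg_tensor A B)"
  obtains r where "r \<in> tensor_free A B" "X = tensor_class A B r"
  using assms unfolding carrier_alg_tensor by (auto elim: quotientE)

lemma alg_tensor_add: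
  assumes "r \<in> tensor_free A B" "s \<in> tensor_free A B"
  shows "tensor_class A B r \<oplus>\<^bsub>alg_tensor A B\<^esub> tensor_class A B s = tensor_class A B (r + s)"
proof -
  have "congruent2 (tensor_rel A B) (tensor_rel A B) (\<lambda>r s. tensor_class A B (r + s))"
  proof (rule congruent2I')
    fix r r' s s' assume rs: "(r, r') \<in> tensor_rel A B" "(s, s') \<in> tensor_rel A B"
    have "(r - r') + (s - s') \<in> tensor_null A B"
      using rs by (intro tensor_null.add) (auto simp: tensor_rel_def)
    then show "tensor_class A B (r + s) = tensor_class A B (r' + s')"
      using rs by (intro tensor_class_eqI) (auto simp: tensor_rel_def tensor_free_add algebra_simps)
  qed
  from UN_equiv_class2[OF equiv_tensor_rel equiv_tensor_rel this assms] show ?thesis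
    by (simp add: alg_tensor_def)
qed

lemma alg_tensor_smult:
  assumes "r \<in> tensor_free A B"
  shows "c \<odot>\<^bsub>alg_tensor A B\<^esub> tensor_class A B r = tensor_class A B (scale c r)"
proof -
  have "(\<lambda>r. tensor_class A B (scale c r)) respects tensor_rel A B"
  proof (rule congruentI)
    fix r s assume "(r, s) \<in> tensor_rel A B"
    then show "tensor_class A B (scale c r) = tensor_class A B (scale c s)"
      by (intro tensor_class_eqI)
        (auto simp: tensor_rel_def tensor_free_scale simp flip: scale_diff intro: tensor_null.scale)
  qed
  from UN_equiv_class[OF equiv_tensor_rel this assms] show ?thesis
    by (simp add: alg_tensor_def)
qed

lemma add_smult_closed_alg_tensor: "add_smult_closed (alg_tensor A B)"
  by (auto simp: add_smult_closed_def alg_tensor_add alg_tensor_smult tensor_class_closed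
      tensor_free_add tensor_free_scale elim!: carrier_alg_tensorE)

lemma pure_tensor_closed:
  "a \<in> carrier A \<Longrightarrow> b \<in> carrier B \<Longrightarrow> pure_tensor A B a b \<in> carrier (alg_tensor A B)"
  by (simp add: pure_tensor_def tensor_class_closed tensor_free_single)

text \<open>
  The class of the zero function is a case of its own because a carrier could be empty, and then there
  is no elementary tensor to multiply by the scalar zero.
\<close>

lemma alg_tensor_induct [consumes 1, case_names zero add smult pure]:
  assumes "X \<in> carrier (alg_tensor A B)"
    and zero: "P (tensor_class A B 0)"
    and add: "\<And>X Y. X \<in> carrier (alg_tensor A B) \<Longrightarrow> Y \<in> carrier (alg_tensor A B) \<Longrightarrow>
      P X \<Longrightarrow> P Y \<Longrightarrow> P (X \<oplus>\<^bsub>alg_tensor A B\<^esub> Y)"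
    and smult: "\<And>c X. X \<in> carrier (alg_tensor A B) \<Longrightarrow> P X \<Longrightarrow> P (c \<odot>\<^bsub>alg_tensor A B\<^esub> X)"
    and pure: "\<And>a b. a \<in> carrier A \<Longrightarrow> b \<in> carrier B \<Longrightarrow> P (pure_tensor A B a b)"
  shows "P X"
proof -
  obtain r where r: "r \<in> tensor_free A B" "X = tensor_class A B r"
    using assms(1) by (rule carrier_alg_tensorE)
  have "P (tensor_class A B (\<Sum>p\<in>S. Poly_Mapping.single p (c p))) \<and>
      (\<Sum>p\<in>S. Poly_Mapping.single p (c p)) \<in> tensor_free A B"
    if "finite S" "S \<subseteq> carrier A \<times> carrier B" for S c
    using that
  proof (induction S rule: finite_induct)
    case empty
    then show ?case using zero by (simp add: tensor_free_zero)
  next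
    case (insert p S)
    obtain a b where p: "p = (a, b)" "a \<in> carrier A" "b \<in> carrier B"
      using insert.prems by (cases p) auto
    have eq: "c p \<odot>\<^bsub>alg_tensor A B\<^esub> pure_tensor A B a b = tensor_class A B (Poly_Mapping.single p (c p))"
      using p by (simp add: pure_tensor_def alg_tensor_smult tensor_free_single scale_single)
    have single: "P (tensor_class A B (Poly_Mapping.single p (c p)))"
      using smult[OF pure_tensor_closed pure, of a b "c p"] p eq by simp
    have free: "Poly_Mapping.single p (c p) \<in> tensor_free A B"
      using p by (simp add: tensor_free_single)
    have IH: "P (tensor_class A B (\<Sum>p\<in>S. Poly_Mapping.single p (c p)))"
      "(\<Sum>p\<in>S. Poly_Mapping.single p (c p)) \<in> tensor_free A B"
      using insert by auto
    show ?case
      using add[OF _ _ single IH(1)] free IH(2) insert(1,2)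
      by (simp add: tensor_class_closed alg_tensor_add tensor_free_add)
  qed
  from this[of "Poly_Mapping.keys r" "Poly_Mapping.lookup r"] r(1)
  have "P (tensor_class A B (\<Sum>p\<in>Poly_Mapping.keys r. Poly_Mapping.single p (Poly_Mapping.lookup r p)))"
    by (simp add: tensor_free_def)
  moreover have "r = (\<Sum>p\<in>Poly_Mapping.keys r. Poly_Mapping.single p (Poly_Mapping.lookup r p))"
    by (intro poly_mapping_eqI) (auto simp: lookup_sum lookup_single when_def in_keys_iff if_distrib
        sum.delta cong: if_cong)
  ultimately show ?thesis
    using r(2) by simp
qed

text \<open>
  The value at zero is zero, because zero is its own multiple by the scalar zero and the target
  satisfies the vector space axioms.
\<close>

lemma linear_between_eqI:
  assumes A: "star_algebra A"
    and F: "linear_between (alg_tensor C D) A F" and G: "linear_between (alg_tensor C D) A G"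
    and eq: "\<And>c d. c \<in> carrier C \<Longrightarrow> d \<in> carrier D \<Longrightarrow> F (pure_tensor C D c d) = G (pure_tensor C D c d)"
    and X: "X \<in> carrier (alg_tensor C D)"
  shows "F X = G X"
  using X
proof (induction rule: alg_tensor_induct)
  case zero
  interpret star_algebra A by (rule A)
  have c: "tensor_class C D 0 \<in> carrier (alg_tensor C D)"
    by (intro tensor_class_closed tensor_free_zero)
  have "0 \<odot>\<^bsub>alg_tensor C D\<^esub> tensor_class C D 0 = tensor_class C D 0"
    by (simp add: alg_tensor_smult tensor_free_zero scale_0)
  then have *: "H (tensor_class C D 0) = \<zero>\<^bsub>A\<^esub>" if "linear_between (alg_tensor C D) A H" for H
    using that c unfolding linear_between_def by (metis smult_0)
  show ?case using *[OF F] *[OF G] by simp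
next
  case (add X Y)
  then show ?case using F G by (simp add: linear_between_def)
next
  case (smult c X)
  then show ?case using F G by (simp add: linear_between_def)
next
  case (pure a b)
  then show ?case by (rule eq)
qed

lemma linear_between_eq_iff:
  assumes A: "star_algebra A"
    and F: "linear_between (alg_tensor C D) A F" and G: "linear_between (alg_tensor C D) A G"
  shows "(\<forall>X\<in>carrier (alg_tensor C D). F X = G X) \<longleftrightarrow>
    (\<forall>c\<in>carrier C. \<forall>d\<in>carrier D. F (pure_tensor C D c d) = G (pure_tensor C D c d))"
  using linear_between_eqI[OF A F G] by (auto simp: pure_tensor_closed)

text \<open>
  The map \<open>f \<otimes> g\<close> on representatives, before passing to the quotient by \<open>tensor_null\<close>.
\<close>

definition tensor_lift :: "('a \<Rightarrow> 'c) \<Rightarrow> ('b \<Rightarrow> 'd) \<Rightarrow> ('a \<times> 'b \<Rightarrow>\<^sub>0 complex) \<Rightarrow> ('c \<times> 'd \<Rightarrow>\<^sub>0 complex)" where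
  "tensor_lift f g r = (\<Sum>(a, b)\<in>Poly_Mapping.keys r.
     Poly_Mapping.single (f a, g b) (Poly_Mapping.lookup r (a, b)))"

lemma tensor_lift_superset:
  assumes "finite S" "Poly_Mapping.keys r \<subseteq> S"
  shows "tensor_lift f g r = (\<Sum>(a, b)\<in>S. Poly_Mapping.single (f a, g b) (Poly_Mapping.lookup r (a, b)))"
  unfolding tensor_lift_def using assms by (intro sum.mono_neutral_left) (auto simp: in_keys_iff)

lemma tensor_lift_add: "tensor_lift f g (r + s) = tensor_lift f g r + tensor_lift f g s"
proof -
  let ?S = "Poly_Mapping.keys r \<union> Poly_Mapping.keys s"
  show ?thesis
    using Poly_Mapping.keys_add[of r s]
    by (subst (1 2 3) tensor_lift_superset[of ?S])
      (auto simp: lookup_add single_add case_prod_beta sum.distrib)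
qed

lemma tensor_lift_single: "tensor_lift f g (Poly_Mapping.single (a, b) c) = Poly_Mapping.single (f a, g b) c"
  by (subst tensor_lift_superset[of "{(a, b)}"]) auto

lemma tensor_lift_scale: "tensor_lift f g (scale c r) = scale c (tensor_lift f g r)"
  by (subst tensor_lift_superset[OF _ keys_scale])
    (auto simp: tensor_lift_def scale_sum scale_single lookup_scale case_prod_beta)

lemma tensor_lift_diff: "tensor_lift f g (r - s) = tensor_lift f g r - tensor_lift f g s"
  using tensor_lift_add[of f g "r - s" s] by simp

lemma tensor_lift_free:
  assumes f: "linear_between C A f" and g: "linear_between D B g" and r: "r \<in> tensor_free C D"
  shows "tensor_lift f g r \<in> tensor_free A B"
proof -
  have "Poly_Mapping.keys (tensor_lift f g r) \<subseteq>
      (\<Union>p\<in>Poly_Mapping.keys r. {(f (fst p), g (snd p))})"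
    unfolding tensor_lift_def by (rule order_trans[OF keys_sum]) (auto simp: case_prod_beta)
  then show ?thesis
    using f g r by (force simp: tensor_free_def linear_between_def)
qed

lemma tensor_lift_null:
  assumes f: "linear_between C A f" and g: "linear_between D B g" and r: "r \<in> tensor_null C D"
  shows "tensor_lift f g r \<in> tensor_null A B"
  using r
proof (induction rule: tensor_null.induct)
  case zero
  then show ?case by (simp add: tensor_lift_def tensor_null.zero)
next
  case (add r s)
  then show ?case by (simp add: tensor_lift_add tensor_null.add)
next
  case (scale r c)
  then show ?case by (simp add: tensor_lift_scale tensor_null.scale)
next
  case (add_left a a' b)
  then show ?case
    using f g by (simp add: tensor_lift_diff tensor_lift_single linear_between_def tensor_null.add_left)
next
  case (add_right a b b')
  then show ?case
    using f g by (simp add: tensor_lift_diff tensor_lift_single linear_between_def tensor_null.add_right)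
next
  case (smult_left a b c)
  then show ?case
    using f g by (simp add: tensor_lift_diff tensor_lift_single linear_between_def tensor_null.smult_left)
next
  case (smult_right a b c)
  then show ?case
    using f g by (simp add: tensor_lift_diff tensor_lift_single linear_between_def tensor_null.smult_right)
qed

lemma tensor_map_class:
  assumes f: "linear_between C A f" and g: "linear_between D B g" and r: "r \<in> tensor_free C D"
  shows "tensor_map A B f g (tensor_class C D r) = tensor_class A B (tensor_lift f g r)"
proof -
  have "(\<lambda>r. tensor_class A B (tensor_lift f g r)) respects tensor_rel C D"
  proof (rule congruentI)
    fix r s assume "(r, s) \<in> tensor_rel C D"
    then show "tensor_class A B (tensor_lift f g r) = tensor_class A B (tensor_lift f g s)"
      by (intro tensor_class_eqI)
        (auto simp: tensor_rel_def tensor_lift_free[OF f g] simp flip: tensor_lift_diff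
          intro: tensor_lift_null[OF f g])
  qed
  from UN_equiv_class[OF equiv_tensor_rel this r] show ?thesis
    by (simp add: tensor_map_def tensor_lift_def)
qed

lemma linear_between_tensor_map:
  assumes f: "linear_between C A f" and g: "linear_between D B g"
  shows "linear_between (alg_tensor C D) (alg_tensor A B) (tensor_map A B f g)"
  unfolding linear_between_def
  by (auto elim!: carrier_alg_tensorE simp: tensor_map_class[OF f g] tensor_lift_free[OF f g]
      tensor_class_closed alg_tensor_add alg_tensor_smult tensor_free_add tensor_free_scale
      tensor_lift_add tensor_lift_scale)

lemma tensor_map_pure_tensor:
  assumes f: "linear_between C A f" and g: "linear_between D B g"
    and "c \<in> carrier C" "d \<in> carrier D"
  shows "tensor_map A B f g (pure_tensor C D c d) = pure_tensor A B (f c) (g d)"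
  using assms by (simp add: pure_tensor_def tensor_map_class tensor_free_single tensor_lift_single)

context star_algebra begin

text \<open>Multiplication on representatives, before passing to the quotient.\<close>

definition mult_lift :: "('a \<times> 'a \<Rightarrow>\<^sub>0 complex) \<Rightarrow> 'a" where
  "mult_lift r = (\<Oplus>p\<in>Poly_Mapping.keys r. Poly_Mapping.lookup r p \<odot> (fst p \<otimes> snd p))"

lemma mult_lift_superset:
  assumes "finite S" "Poly_Mapping.keys r \<subseteq> S" "S \<subseteq> carrier A \<times> carrier A"
  shows "mult_lift r = (\<Oplus>p\<in>S. Poly_Mapping.lookup r p \<odot> (fst p \<otimes> snd p))"
  unfolding mult_lift_def using assms
  by (intro add.finprod_mono_neutral_cong_left) (auto simp: in_keys_iff subset_iff)

lemma mult_lift_closed: "r \<in> tensor_free A A \<Longrightarrow> mult_lift r \<in> carrier A"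
  unfolding mult_lift_def by (intro finsum_closed) (auto simp: tensor_free_def)

lemma mult_lift_add:
  assumes "r \<in> tensor_free A A" "s \<in> tensor_free A A"
  shows "mult_lift (r + s) = mult_lift r \<oplus> mult_lift s"
proof -
  let ?S = "Poly_Mapping.keys r \<union> Poly_Mapping.keys s"
  have S: "finite ?S" "?S \<subseteq> carrier A \<times> carrier A"
    using assms by (auto simp: tensor_free_def)
  have "mult_lift (r + s) = (\<Oplus>p\<in>?S. Poly_Mapping.lookup (r + s) p \<odot> (fst p \<otimes> snd p))"
    using S Poly_Mapping.keys_add[of r s] by (intro mult_lift_superset) auto
  also have "\<dots> = (\<Oplus>p\<in>?S. Poly_Mapping.lookup r p \<odot> (fst p \<otimes> snd p) \<oplus> Poly_Mapping.lookup s p \<odot> (fst p \<otimes> snd p))"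
    using S by (intro finsum_cong') (auto simp: lookup_add smult_add_scalar)
  also have "\<dots> = (\<Oplus>p\<in>?S. Poly_Mapping.lookup r p \<odot> (fst p \<otimes> snd p)) \<oplus> (\<Oplus>p\<in>?S. Poly_Mapping.lookup s p \<odot> (fst p \<otimes> snd p))"
    using S by (intro finsum_addf) auto
  also have "\<dots> = mult_lift r \<oplus> mult_lift s"
    using S by (simp add: mult_lift_superset[of ?S])
  finally show ?thesis .
qed

lemma mult_lift_scale:
  assumes "r \<in> tensor_free A A"
  shows "mult_lift (scale c r) = c \<odot> mult_lift r"
proof -
  let ?S = "Poly_Mapping.keys r"
  have S: "finite ?S" "?S \<subseteq> carrier A \<times> carrier A"
    using assms by (auto simp: tensor_free_def)
  have "mult_lift (scale c r) = (\<Oplus>p\<in>?S. Poly_Mapping.lookup (scale c r) p \<odot> (fst p \<otimes> snd p))"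
    using S by (intro mult_lift_superset keys_scale)
  also have "\<dots> = (\<Oplus>p\<in>?S. c \<odot> (Poly_Mapping.lookup r p \<odot> (fst p \<otimes> snd p)))"
    using S by (intro finsum_cong') (auto simp: lookup_scale smult_smult)
  also have "\<dots> = c \<odot> mult_lift r"
    unfolding mult_lift_def using S
    by (intro finsum_smult_ldistr[symmetric]) (auto simp: complex_ring_def)
  finally show ?thesis .
qed

lemma mult_lift_single:
  assumes "a \<in> carrier A" "b \<in> carrier A"
  shows "mult_lift (Poly_Mapping.single (a, b) c) = c \<odot> (a \<otimes> b)"
  using assms by (subst mult_lift_superset[of "{(a, b)}"]) auto

lemma mult_lift_diff:
  assumes "r \<in> tensor_free A A" "s \<in> tensor_free A A"
  shows "mult_lift (r - s) = mult_lift r \<ominus> mult_lift s"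
proof -
  have "mult_lift (r + scale (- 1) s) = mult_lift r \<oplus> (- 1) \<odot> mult_lift s"
    using assms by (simp only: mult_lift_add mult_lift_scale tensor_free_scale)
  then show ?thesis
    using assms by (simp add: scale_minus_1 minus_eq_smult mult_lift_closed)
qed

lemma mult_lift_null:
  assumes "r \<in> tensor_null A A"
  shows "r \<in> tensor_free A A \<and> mult_lift r = \<zero>"
  using assms
proof (induction rule: tensor_null.induct)
  case zero
  then show ?case by (simp add: mult_lift_def tensor_free_zero)
next
  case (add r s)
  then show ?case by (simp add: mult_lift_add tensor_free_add)
next
  case (scale r c)
  then show ?case by (simp add: mult_lift_scale tensor_free_scale)
qed (simp_all add: mult_lift_diff mult_lift_single tensor_free_single tensor_free_diff
    expand_simps a_ac smult_collect)

lemma mult_map_class: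
  assumes r: "r \<in> tensor_free A A"
  shows "mult_map A (tensor_class A A r) = mult_lift r"
proof -
  have "mult_lift s = mult_lift r" if "s \<in> tensor_class A A r" for s
  proof -
    have s: "s \<in> tensor_free A A" "r - s \<in> tensor_null A A"
      using that by (auto simp: tensor_rel_def)
    then have "mult_lift ((r - s) + s) = mult_lift s"
      using mult_lift_null[OF s(2)] by (subst mult_lift_add) (auto simp: mult_lift_closed)
    then show ?thesis by simp
  qed
  moreover have "r \<in> tensor_class A A r"
    using r by (rule equiv_class_self[OF equiv_tensor_rel])
  ultimately have "mult_lift ` tensor_class A A r = {mult_lift r}"
    by blast
  then show ?thesis
    by (simp add: mult_map_def mult_lift_def)
qed

lemma linear_between_mult_map: "linear_between (alg_tensor A A) A (mult_map A)"
  unfolding linear_between_def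
  by (auto elim!: carrier_alg_tensorE simp: mult_map_class mult_lift_closed
      alg_tensor_add alg_tensor_smult tensor_free_add tensor_free_scale mult_lift_add mult_lift_scale)

lemma mult_map_pure_tensor:
  "a \<in> carrier A \<Longrightarrow> b \<in> carrier A \<Longrightarrow> mult_map A (pure_tensor A A a b) = a \<otimes> b"
  by (simp add: pure_tensor_def mult_map_class tensor_free_single mult_lift_single)

end

section \<open>Almost sure equality on elementary tensors\<close>

lemma carrier_tensor: "carrier (tensor t A B) = carrier (alg_tensor A B)"
  by (simp add: tensor_def with_nrm_def star_alg.extend_def)

lemma add_tensor: "add (tensor t A B) = add (alg_tensor A B)"
  by (simp add: tensor_def with_nrm_def star_alg.extend_def)

lemma smult_tensor: "smult (tensor t A B) = smult (alg_tensor A B)"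
  by (simp add: tensor_def with_nrm_def star_alg.extend_def)

lemmas tensor_simps = carrier_tensor add_tensor smult_tensor

lemma linear_between_tensor_source:
  "linear_between (tensor t A B) C f \<longleftrightarrow> linear_between (alg_tensor A B) C f"
  by (simp add: linear_between_def tensor_simps)

lemma linear_between_tensor_target:
  "linear_between C (tensor t A B) f \<longleftrightarrow> linear_between C (alg_tensor A B) f"
  by (simp add: linear_between_def tensor_simps)

lemma unital_linear_maps_linear: "f \<in> unital_linear_maps A B \<Longrightarrow> linear_between A B f"
  by (auto simp: unital_linear_maps_def linear_between_def)

lemma compose_eq_iff:
  "compose S f g = compose S f' g' \<longleftrightarrow> (\<forall>x\<in>S. f (g x) = f' (g' x))"
  by (auto simp: compose_def fun_eq_iff)

lemma arr_comp_eq_iff: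
  assumes "source \<phi> = source \<phi>'" "target \<psi> = target \<psi>'"
  shows "\<psi> \<cdot> \<phi> = \<psi>' \<cdot> \<phi>' \<longleftrightarrow>
    (\<forall>x\<in>carrier (target \<psi>). opp \<phi> (opp \<psi> x) = opp \<phi>' (opp \<psi>' x))"
  using assms by (simp add: arr_comp_def compose_eq_iff)

lemma opp_copy_comp:
  assumes B: "target \<omega> = B" and X: "X \<in> carrier (alg_tensor B B)"
  shows "opp (copy t B \<cdot> \<omega>) X = opp \<omega> (mult_map B X)"
  using assms by (simp add: arr_comp_def copy_def compose_def carrier_tensor)

context
  fixes t :: tensor_kind
    and A :: "'a pre_cstar" and B :: "'b pre_cstar" and \<omega> :: "('a, 'b) arrow"
  assumes \<omega>: "\<omega> \<in> gen_hom A B"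
begin

lemma gen_hom_facts:
  shows gen_hom_source: "pre_cstar_algebra A" and gen_hom_target: "pre_cstar_algebra B"
    and source_eq: "source \<omega> = A" and target_eq: "target \<omega> = B"
    and opp_linear: "linear_between B A (opp \<omega>)"
  using \<omega> by (auto simp: gen_hom_def unital_linear_maps_linear)

lemma star_algebras: "star_algebra A" "star_algebra B"
  using gen_hom_source gen_hom_target by (simp_all add: pre_cstar_algebra_def)

lemma mult_map_lin: "linear_between (alg_tensor B B) B (mult_map B)"
  by (rule star_algebra.linear_between_mult_map[OF star_algebras(2)])

lemma copy_after_tensor_eq_iff:
  assumes f: "linear_between C B f" "linear_between C B f'" and g: "linear_between D B g" "linear_between D B g'"
  shows "(\<forall>X\<in>carrier (alg_tensor C D). opp \<omega> (mult_map B (tensor_map B B f g X)) =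
        opp \<omega> (mult_map B (tensor_map B B f' g' X))) \<longleftrightarrow>
    (\<forall>c\<in>carrier C. \<forall>d\<in>carrier D. opp \<omega> (f c \<otimes>\<^bsub>B\<^esub> g d) = opp \<omega> (f' c \<otimes>\<^bsub>B\<^esub> g' d))"
proof -
  have l: "linear_between (alg_tensor C D) A (\<lambda>X. opp \<omega> (mult_map B (tensor_map B B h k X)))"
    if "linear_between C B h" "linear_between D B k" for h k
    by (rule linear_between_compose[OF linear_between_compose[OF linear_between_tensor_map[OF that] mult_map_lin] opp_linear])
  have p: "opp \<omega> (mult_map B (tensor_map B B h k (pure_tensor C D c d))) = opp \<omega> (h c \<otimes>\<^bsub>B\<^esub> k d)"
    if "linear_between C B h" "linear_between D B k" "c \<in> carrier C" "d \<in> carrier D" for h k c d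
    using that star_algebra.mult_map_pure_tensor[OF star_algebras(2), of "h c" "k d"]
    by (simp add: tensor_map_pure_tensor[OF that]) (simp add: linear_between_def)
  show ?thesis
    unfolding linear_between_eq_iff[OF star_algebras(1) l[OF f(1) g(1)] l[OF f(2) g(2)]]
    by (simp add: p[OF f(1) g(1)] p[OF f(2) g(2)])
qed

lemma id_lin: "linear_between B B (\<lambda>x\<in>carrier B. x)"
  using star_algebra.add_smult_closed[OF star_algebras(2)]
  by (auto simp: linear_between_def add_smult_closed_def)

lemma opp_copy_comp_tensor:
  assumes "source f = B" "source g = B" "target f = C" "target g = D"
    and f: "linear_between C B (opp f)" and g: "linear_between D B (opp g)"
    and X: "X \<in> carrier (alg_tensor C D)"
  shows "opp (copy t B \<cdot> \<omega>) (opp (arr_tensor t f g) X) =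
    opp \<omega> (mult_map B (tensor_map B B (opp f) (opp g) X))"
proof -
  have "tensor_map B B (opp f) (opp g) X \<in> carrier (alg_tensor B B)"
    using linear_between_tensor_map[OF f g] X by (simp add: linear_between_def)
  then show ?thesis
    using opp_copy_comp[OF target_eq] assms by (simp add: arr_tensor_def carrier_tensor)
qed

lemma arr_tensor_copy_eq_iff:
  assumes f: "source f = B" "target f = C" "linear_between C B (opp f)"
    and f': "source f' = B" "target f' = C" "linear_between C B (opp f')"
    and g: "source g = B" "target g = D" "linear_between D B (opp g)"
    and g': "source g' = B" "target g' = D" "linear_between D B (opp g')"
  shows "arr_tensor t f g \<cdot> copy t B \<cdot> \<omega> = arr_tensor t f' g' \<cdot> copy t B \<cdot> \<omega> \<longleftrightarrow>
    (\<forall>c\<in>carrier C. \<forall>d\<in>carrier D.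
      opp \<omega> (opp f c \<otimes>\<^bsub>B\<^esub> opp g d) = opp \<omega> (opp f' c \<otimes>\<^bsub>B\<^esub> opp g' d))"
proof -
  have tg: "target (arr_tensor t f g) = tensor t C D" "target (arr_tensor t f' g') = tensor t C D"
    using assms by (simp_all add: arr_tensor_def)
  show ?thesis
    unfolding copy_after_tensor_eq_iff[OF f(3) f'(3) g(3) g'(3), symmetric]
    by (subst arr_comp_eq_iff)
      (simp_all add: tg carrier_tensor opp_copy_comp_tensor[OF f(1) g(1) f(2) g(2) f(3) g(3)]
        opp_copy_comp_tensor[OF f'(1) g'(1) f'(2) g'(2) f'(3) g'(3)])
qed

lemma opp_arr_id_lin: "linear_between B B (opp (arr_id B))"
  using id_lin by (simp add: arr_id_def)

lemma opp_copy_lin: "linear_between (tensor t B B) B (opp (copy t B))"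
  using linear_between_restrict[OF mult_map_lin add_smult_closed_alg_tensor]
  by (simp add: copy_def linear_between_tensor_source carrier_tensor)

lemma opp_arr_tensor_id_lin:
  assumes "source f = B" "target f = C" "linear_between C B (opp f)"
  shows "linear_between (tensor t B C) (tensor t B B) (opp (arr_tensor t (arr_id B) f))"
  using linear_between_restrict[OF linear_between_tensor_map[OF opp_arr_id_lin assms(3)]
      add_smult_closed_alg_tensor] assms
  by (simp add: arr_tensor_def arr_id_def linear_between_tensor_source linear_between_tensor_target
      carrier_tensor)

lemma opp_copy3_comp:
  assumes Y: "Y \<in> carrier (alg_tensor (tensor t B B) B)"
  shows "opp (copy3 t B \<cdot> \<omega>) Y =
    opp \<omega> (mult_map B (tensor_map B B (opp (copy t B)) (opp (arr_id B)) Y))"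
proof -
  have "tensor_map B B (opp (copy t B)) (opp (arr_id B)) Y \<in> carrier (alg_tensor B B)"
    using linear_between_tensor_map[OF opp_copy_lin opp_arr_id_lin] Y by (simp add: linear_between_def)
  moreover have "opp (copy3 t B \<cdot> \<omega>) Y =
      opp \<omega> (opp (copy t B) (opp (arr_tensor t (copy t B) (arr_id B)) Y))"
    using Y by (simp add: copy3_def arr_comp_def compose_def arr_tensor_def copy_def arr_id_def carrier_tensor)
  ultimately show ?thesis
    using Y by (simp add: arr_tensor_def carrier_tensor) (simp add: copy_def arr_id_def carrier_tensor)
qed

text \<open>
  The outer tensor factor is handled first: the opposites agree if and only if they agree on
  \<open>Z \<otimes> b'\<close> for all \<open>Z\<close> in \<open>B \<odot> C\<close>. For fixed \<open>b'\<close> the value is linear in \<open>Z\<close>, so it suffices to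
  take \<open>Z = b \<otimes> c\<close>.
\<close>

lemma arr_tensor_copy3_eq_iff:
  fixes f f' :: "('b, 'c) arrow"
  assumes f: "source f = B" "target f = C" "linear_between C B (opp f)"
    and f': "source f' = B" "target f' = C" "linear_between C B (opp f')"
  shows "arr_tensor t (arr_tensor t (arr_id B) f) (arr_id B) \<cdot> copy3 t B \<cdot> \<omega> =
      arr_tensor t (arr_tensor t (arr_id B) f') (arr_id B) \<cdot> copy3 t B \<cdot> \<omega> \<longleftrightarrow>
    (\<forall>b\<in>carrier B. \<forall>c\<in>carrier C. \<forall>b'\<in>carrier B.
      opp \<omega> ((b \<otimes>\<^bsub>B\<^esub> opp f c) \<otimes>\<^bsub>B\<^esub> b') = opp \<omega> ((b \<otimes>\<^bsub>B\<^esub> opp f' c) \<otimes>\<^bsub>B\<^esub> b'))"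
proof -
  interpret B: star_algebra B by (rule star_algebras(2))
  let ?T = "alg_tensor (tensor t B C) B"
  define h where "h k = opp (arr_tensor t (arr_id B) k)" for k :: "('b, 'c) arrow"
  define V where "V k X = opp \<omega> (mult_map B (tensor_map B B (opp (copy t B)) (opp (arr_id B))
      (tensor_map (tensor t B B) B (h k) (opp (arr_id B)) X)))" for k :: "('b, 'c) arrow" and X
  have main: "linear_between ?T A (V k) \<and>
      (\<forall>X\<in>carrier ?T. opp (copy3 t B \<cdot> \<omega>) (opp (arr_tensor t (arr_tensor t (arr_id B) k) (arr_id B)) X) = V k X) \<and>
      (\<forall>Z\<in>carrier (alg_tensor B C). \<forall>b\<in>carrier B.
        V k (pure_tensor (tensor t B C) B Z b) = opp \<omega> (mult_map B (h k Z) \<otimes>\<^bsub>B\<^esub> b)) \<and>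
      (\<forall>b\<in>carrier B. linear_between (alg_tensor B C) A (\<lambda>Z. opp \<omega> (mult_map B (h k Z) \<otimes>\<^bsub>B\<^esub> b))) \<and>
      (\<forall>b\<in>carrier B. \<forall>c\<in>carrier C. mult_map B (h k (pure_tensor B C b c)) = b \<otimes>\<^bsub>B\<^esub> opp k c)"
    if k: "source k = B" "target k = C" "linear_between C B (opp k)" for k :: "('b, 'c) arrow"
  proof (intro conjI ballI)
    have hk: "linear_between (tensor t B C) (tensor t B B) (h k)"
      unfolding h_def by (rule opp_arr_tensor_id_lin[OF k])
    have hk': "linear_between (alg_tensor B C) (alg_tensor B B) (h k)"
      using hk by (simp add: linear_between_tensor_source linear_between_tensor_target)
    note outer = linear_between_tensor_map[OF hk opp_arr_id_lin]
    note inner = linear_between_tensor_map[OF opp_copy_lin opp_arr_id_lin]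
    show "linear_between ?T A (V k)"
      unfolding V_def
      by (rule linear_between_compose[OF linear_between_compose[OF linear_between_compose[OF outer inner]
            mult_map_lin] opp_linear])
    show "opp (copy3 t B \<cdot> \<omega>) (opp (arr_tensor t (arr_tensor t (arr_id B) k) (arr_id B)) X) = V k X"
      if X: "X \<in> carrier ?T" for X
    proof -
      have "tensor_map (tensor t B B) B (h k) (opp (arr_id B)) X \<in> carrier (alg_tensor (tensor t B B) B)"
        using outer X by (simp add: linear_between_def)
      from opp_copy3_comp[OF this] show ?thesis
        using X k by (simp add: V_def h_def arr_tensor_def carrier_tensor) (simp add: arr_id_def carrier_tensor)
    qed
    show "V k (pure_tensor (tensor t B C) B Z b) = opp \<omega> (mult_map B (h k Z) \<otimes>\<^bsub>B\<^esub> b)"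
      if Z: "Z \<in> carrier (alg_tensor B C)" and b: "b \<in> carrier B" for Z b
    proof -
      have hZ: "h k Z \<in> carrier (alg_tensor B B)"
        using hk' Z by (simp add: linear_between_def)
      have m: "mult_map B (h k Z) \<in> carrier B"
        using mult_map_lin hZ by (simp add: linear_between_def)
      show ?thesis
        using tensor_map_pure_tensor[OF hk opp_arr_id_lin, of Z b]
          tensor_map_pure_tensor[OF opp_copy_lin opp_arr_id_lin, of "h k Z" b]
          B.mult_map_pure_tensor[OF m b] Z b hZ
        by (simp add: V_def carrier_tensor) (simp add: arr_id_def copy_def carrier_tensor)
    qed
    show "linear_between (alg_tensor B C) A (\<lambda>Z. opp \<omega> (mult_map B (h k Z) \<otimes>\<^bsub>B\<^esub> b))"
      if b: "b \<in> carrier B" for b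
    proof -
      have "linear_between B B (\<lambda>x. x \<otimes>\<^bsub>B\<^esub> b)"
        using b by (auto simp: linear_between_def B.l_distr B.smult_mult_left)
      then show ?thesis
        by (rule linear_between_compose[OF linear_between_compose[OF
              linear_between_compose[OF hk' mult_map_lin]] opp_linear])
    qed
    show "mult_map B (h k (pure_tensor B C b c)) = b \<otimes>\<^bsub>B\<^esub> opp k c"
      if b: "b \<in> carrier B" and c: "c \<in> carrier C" for b c
    proof -
      have "h k (pure_tensor B C b c) = pure_tensor B B b (opp k c)"
        using tensor_map_pure_tensor[OF opp_arr_id_lin k(3) b c] k pure_tensor_closed[OF b c] b
        by (simp add: h_def arr_tensor_def carrier_tensor) (simp add: arr_id_def carrier_tensor)
      then show ?thesis
        using B.mult_map_pure_tensor[OF b, of "opp k c"] k c by (simp add: linear_between_def)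
    qed
  qed
  note F = main[OF f] and F' = main[OF f']
  have tg: "target (arr_tensor t (arr_tensor t (arr_id B) k) (arr_id B)) = tensor t (tensor t B C) B"
    if "target k = C" for k :: "('b, 'c) arrow"
    using that by (simp add: arr_tensor_def arr_id_def)
  have "?thesis \<longleftrightarrow> (\<forall>X\<in>carrier ?T. V f X = V f' X) =
    (\<forall>b\<in>carrier B. \<forall>c\<in>carrier C. \<forall>b'\<in>carrier B.
      opp \<omega> ((b \<otimes>\<^bsub>B\<^esub> opp f c) \<otimes>\<^bsub>B\<^esub> b') = opp \<omega> ((b \<otimes>\<^bsub>B\<^esub> opp f' c) \<otimes>\<^bsub>B\<^esub> b'))"
    by (subst arr_comp_eq_iff) (use F F' in \<open>simp_all add: tg f(2) f'(2) carrier_tensor\<close>)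
  also have "(\<forall>X\<in>carrier ?T. V f X = V f' X) \<longleftrightarrow>
      (\<forall>Z\<in>carrier (alg_tensor B C). \<forall>b'\<in>carrier B.
        opp \<omega> (mult_map B (h f Z) \<otimes>\<^bsub>B\<^esub> b') = opp \<omega> (mult_map B (h f' Z) \<otimes>\<^bsub>B\<^esub> b'))"
    using F F' by (subst linear_between_eq_iff[OF star_algebras(1)]) (auto simp: carrier_tensor)
  also have "\<dots> \<longleftrightarrow> (\<forall>b'\<in>carrier B. \<forall>Z\<in>carrier (alg_tensor B C).
        opp \<omega> (mult_map B (h f Z) \<otimes>\<^bsub>B\<^esub> b') = opp \<omega> (mult_map B (h f' Z) \<otimes>\<^bsub>B\<^esub> b'))"
    by blast
  also have "\<dots> \<longleftrightarrow> (\<forall>b'\<in>carrier B. \<forall>b\<in>carrier B. \<forall>c\<in>carrier C.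
      opp \<omega> ((b \<otimes>\<^bsub>B\<^esub> opp f c) \<otimes>\<^bsub>B\<^esub> b') = opp \<omega> ((b \<otimes>\<^bsub>B\<^esub> opp f' c) \<otimes>\<^bsub>B\<^esub> b'))"
  proof (rule ball_cong[OF refl])
    fix b' assume b': "b' \<in> carrier B"
    show "(\<forall>Z\<in>carrier (alg_tensor B C).
        opp \<omega> (mult_map B (h f Z) \<otimes>\<^bsub>B\<^esub> b') = opp \<omega> (mult_map B (h f' Z) \<otimes>\<^bsub>B\<^esub> b')) \<longleftrightarrow>
      (\<forall>b\<in>carrier B. \<forall>c\<in>carrier C.
        opp \<omega> ((b \<otimes>\<^bsub>B\<^esub> opp f c) \<otimes>\<^bsub>B\<^esub> b') = opp \<omega> ((b \<otimes>\<^bsub>B\<^esub> opp f' c) \<otimes>\<^bsub>B\<^esub> b'))"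
      using F F' b' by (subst linear_between_eq_iff[OF star_algebras(1)]) auto
  qed
  finally show ?thesis by blast
qed

end


theorem theorem3p31:
  fixes t :: tensor_kind
    and A :: "'a pre_cstar" and B :: "'b pre_cstar" and C :: "'c pre_cstar"
    and \<omega> :: "('a, 'b) arrow" and \<phi> \<psi> :: "('b, 'c) arrow"
  assumes "\<omega> \<in> cpu_hom A B"
    and "\<phi> \<in> gen_hom B C" and "\<psi> \<in> gen_hom B C"
  shows "(left_ase t \<omega> \<phi> \<psi> \<longleftrightarrow>
      (\<forall>y\<in>carrier C. opp \<phi> y \<ominus>\<^bsub>B\<^esub> opp \<psi> y \<in> left_nullspace \<omega>)) \<and>
    (right_ase t \<omega> \<phi> \<psi> \<longleftrightarrow>
      (\<forall>y\<in>carrier C. opp \<phi> y \<ominus>\<^bsub>B\<^esub> opp \<psi> y \<in> right_nullspace \<omega>)) \<and>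
    (symmetric_ase t \<omega> \<phi> \<psi> \<longleftrightarrow>
      (\<forall>y\<in>carrier C. opp \<phi> y \<ominus>\<^bsub>B\<^esub> opp \<psi> y \<in> symmetric_nullspace \<omega>))"
proof -
  have \<omega>: "\<omega> \<in> gen_hom A B" and cp: "completely_positive B A (opp \<omega>)"
    using assms(1) by (auto simp: cpu_hom_def)
  note \<omega>_facts = gen_hom_facts[OF \<omega>]
  have ulm: "opp \<omega> \<in> unital_linear_maps B A"
    using \<omega> by (simp add: gen_hom_def)
  interpret A: pre_cstar_algebra A by (rule \<omega>_facts)
  interpret B: pre_cstar_algebra B by (rule \<omega>_facts)
  have \<phi>: "source \<phi> = B" "target \<phi> = C" "linear_between C B (opp \<phi>)"
    and \<psi>: "source \<psi> = B" "target \<psi> = C" "linear_between C B (opp \<psi>)"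
    using assms(2,3) by (auto simp: gen_hom_def unital_linear_maps_linear)
  have i: "source (arr_id B) = B" "target (arr_id B) = B" "linear_between B B (opp (arr_id B))"
    using opp_arr_id_lin[OF \<omega>] by (simp_all add: arr_id_def)
  have i_eq: "opp (arr_id B) b = b" if "b \<in> carrier B" for b
    using that by (simp add: arr_id_def)
  define d where "d y = opp \<phi> y \<ominus>\<^bsub>B\<^esub> opp \<psi> y" for y
  have c: "opp \<phi> y \<in> carrier B" "opp \<psi> y \<in> carrier B" "d y \<in> carrier B" "star B (d y) \<in> carrier B"
    if "y \<in> carrier C" for y
    using that \<phi>(3) \<psi>(3) by (auto simp: d_def linear_between_def intro!: B.star_closed)
  have lin: "opp \<omega> (u \<ominus>\<^bsub>B\<^esub> v) = opp \<omega> u \<ominus>\<^bsub>A\<^esub> opp \<omega> v" and clos: "opp \<omega> u \<in> carrier A"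
    if "u \<in> carrier B" "v \<in> carrier B" for u v
    using that \<omega>_facts(5) by (simp_all add: linear_between_def B.minus_eq_smult A.minus_eq_smult)
  have eq_iff: "opp \<omega> u = opp \<omega> v \<longleftrightarrow> opp \<omega> (u \<ominus>\<^bsub>B\<^esub> v) = \<zero>\<^bsub>A\<^esub>"
    if "u \<in> carrier B" "v \<in> carrier B" for u v
    using lin[OF that] clos[OF that] clos[OF that(2,1)] by (simp add: A.minus_eq_zero_iff)
  note null = cp_null_cross_terms[OF \<omega>_facts(1,2) ulm cp]

  have left: "left_ase t \<omega> \<phi> \<psi> \<longleftrightarrow>
      (\<forall>y\<in>carrier C. \<forall>b\<in>carrier B. opp \<omega> (d y \<otimes>\<^bsub>B\<^esub> b) = \<zero>\<^bsub>A\<^esub>)"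
  proof -
    have "left_ase t \<omega> \<phi> \<psi> \<longleftrightarrow> (\<forall>y\<in>carrier C. \<forall>b\<in>carrier B.
        opp \<omega> (opp \<phi> y \<otimes>\<^bsub>B\<^esub> b) = opp \<omega> (opp \<psi> y \<otimes>\<^bsub>B\<^esub> b))"
      unfolding left_ase_def Let_def \<omega>_facts(4) arr_tensor_copy_eq_iff[OF \<omega> \<phi> \<psi> i i]
      by (simp add: i_eq)
    then show ?thesis
      by (simp add: eq_iff c d_def B.minus_eq B.l_distr B.l_minus)
  qed
  have right: "right_ase t \<omega> \<phi> \<psi> \<longleftrightarrow>
      (\<forall>b\<in>carrier B. \<forall>y\<in>carrier C. opp \<omega> (b \<otimes>\<^bsub>B\<^esub> d y) = \<zero>\<^bsub>A\<^esub>)"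
  proof -
    have "right_ase t \<omega> \<phi> \<psi> \<longleftrightarrow> (\<forall>b\<in>carrier B. \<forall>y\<in>carrier C.
        opp \<omega> (b \<otimes>\<^bsub>B\<^esub> opp \<phi> y) = opp \<omega> (b \<otimes>\<^bsub>B\<^esub> opp \<psi> y))"
      unfolding right_ase_def Let_def \<omega>_facts(4) arr_tensor_copy_eq_iff[OF \<omega> i i \<phi> \<psi>]
      by (simp add: i_eq)
    then show ?thesis
      by (simp add: eq_iff c d_def B.minus_eq B.r_distr B.r_minus)
  qed
  have symmetric: "symmetric_ase t \<omega> \<phi> \<psi> \<longleftrightarrow>
      (\<forall>b\<in>carrier B. \<forall>y\<in>carrier C. \<forall>b'\<in>carrier B. opp \<omega> (b \<otimes>\<^bsub>B\<^esub> d y \<otimes>\<^bsub>B\<^esub> b') = \<zero>\<^bsub>A\<^esub>)"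
    unfolding symmetric_ase_def Let_def \<omega>_facts(4) arr_tensor_copy3_eq_iff[OF \<omega> \<phi> \<psi>]
    by (simp add: eq_iff c d_def B.minus_eq B.r_distr B.r_minus B.l_distr B.l_minus)

  have "(\<forall>b\<in>carrier B. opp \<omega> (d y \<otimes>\<^bsub>B\<^esub> b) = \<zero>\<^bsub>A\<^esub>) \<longleftrightarrow> d y \<in> left_nullspace \<omega>"
    if y: "y \<in> carrier C" for y
    using null[of "star B (d y)"] c[OF y]
    by (auto simp: left_nullspace_def \<omega>_facts B.star_star)
  moreover have "(\<forall>b\<in>carrier B. opp \<omega> (b \<otimes>\<^bsub>B\<^esub> d y) = \<zero>\<^bsub>A\<^esub>) \<longleftrightarrow> d y \<in> right_nullspace \<omega>"
    if y: "y \<in> carrier C" for y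
  proof
    assume "d y \<in> right_nullspace \<omega>"
    then have "opp \<omega> (star B (star B b) \<otimes>\<^bsub>B\<^esub> d y) = \<zero>\<^bsub>A\<^esub>" if "b \<in> carrier B" for b
      using null[of "d y" "star B b"] c[OF y] that by (simp add: right_nullspace_def \<omega>_facts B.star_closed)
    then show "\<forall>b\<in>carrier B. opp \<omega> (b \<otimes>\<^bsub>B\<^esub> d y) = \<zero>\<^bsub>A\<^esub>"
      by (simp add: B.star_star)
  qed (use c[OF y] in \<open>simp add: right_nullspace_def \<omega>_facts\<close>)
  moreover have "(\<forall>b\<in>carrier B. \<forall>b'\<in>carrier B. opp \<omega> (b \<otimes>\<^bsub>B\<^esub> d y \<otimes>\<^bsub>B\<^esub> b') = \<zero>\<^bsub>A\<^esub>) \<longleftrightarrow>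
      d y \<in> symmetric_nullspace \<omega>"
    if y: "y \<in> carrier C" for y
  proof
    assume d: "d y \<in> symmetric_nullspace \<omega>"
    have "opp \<omega> (star B (star B b) \<otimes>\<^bsub>B\<^esub> (d y \<otimes>\<^bsub>B\<^esub> b')) = \<zero>\<^bsub>A\<^esub>"
      if "b \<in> carrier B" "b' \<in> carrier B" for b b'
      using d null[of "d y \<otimes>\<^bsub>B\<^esub> b'" "star B b"] c[OF y] that
      by (simp add: symmetric_nullspace_def \<omega>_facts B.star_closed B.star_mult B.m_assoc)
    then show "\<forall>b\<in>carrier B. \<forall>b'\<in>carrier B. opp \<omega> (b \<otimes>\<^bsub>B\<^esub> d y \<otimes>\<^bsub>B\<^esub> b') = \<zero>\<^bsub>A\<^esub>"
      using c[OF y] by (simp add: B.star_star B.m_assoc)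
  next
    assume "\<forall>b\<in>carrier B. \<forall>b'\<in>carrier B. opp \<omega> (b \<otimes>\<^bsub>B\<^esub> d y \<otimes>\<^bsub>B\<^esub> b') = \<zero>\<^bsub>A\<^esub>"
    then have "opp \<omega> (star B u \<otimes>\<^bsub>B\<^esub> star B (d y) \<otimes>\<^bsub>B\<^esub> d y \<otimes>\<^bsub>B\<^esub> u) = \<zero>\<^bsub>A\<^esub>" if "u \<in> carrier B" for u
      using that c[OF y] by (simp add: B.star_closed)
    then show "d y \<in> symmetric_nullspace \<omega>"
      using c[OF y] by (simp add: symmetric_nullspace_def \<omega>_facts)
  qed
  ultimately show ?thesis
    unfolding left right symmetric d_def[symmetric] by blast
qed

end
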